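(* Let $f:[0,\infty)\to[0,\infty)$ be an increasing function with $\lambda_t f\to\infty$ that satisfies orderly divergence, i.e. $\dfrac{S_tf}{\lambda_t f}\to 1$ in probability as $t\to\infty$. Let $g:[0,\infty)\to[0,\infty)$ be a measurable periodic function (with some period $>0$) whose essential supremum is $\|g\|_\infty=1$. Then there is a constant $C$ such that $$v_t(fg)\le C\,v_t(f)\quad\text{for all sufficiently large } t,$$ where $v_t(h)=\dfrac{\lambda_t(h^2)}{(\lambda_t h)^2}$. Consequently, $fg$ satisfies orderly divergence in $L^p$ for every $p\ge 0$: $$\frac{S_t(fg)}{\lambda_t(fg)}\to 1\quad\text{as } t\to\infty$$ in probability and in $L^p$ for every $0<p<\infty$.
   Context: $(S_t)_{t\ge 0}$ is the standard Gamma process: the increasing Lévy process with $S_0=0$ and $\mathbb{E}e^{-\theta S_t}=(1+\theta)^{-t}$ for $\theta\ge 0$ (so $S_1$ is exponential with mean 1). For a measurable locally integrable $h\ge 0$ put $\lambda_t h=\int_0^t h(x)\,dx$ and $S_t h=\int_0^t h\,dS$ (pathwise integral over $(0,t]$; it is a.s. finite, $\mathbb{E}\,S_th=\lambda_t h$, and $-\ln \mathbb{E}e^{-\theta S_t h}=\int_0^t\ln(1+\theta h(x))\,dx$ for $\theta\ge0$). "Increasing" means non-decreasing. *)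

theory Defs
  imports "HOL-Probability.Probability"
begin

text \<open>
  The path properties (start at 0, right-continuous with left limits) are required of every path
  and not just of almost every one, so that pathwise integrals are defined everywhere and are
  random variables even if the probability space is not complete.
\<close>

locale levy_process = prob_space M for M :: "'a measure" +
  fixes S :: "real \<Rightarrow> 'a \<Rightarrow> real"
  assumes random_variable_S: "t \<ge> 0 \<Longrightarrow> random_variable borel (S t)"
    and start_zero: "\<omega> \<in> space M \<Longrightarrow> S 0 \<omega> = 0"
    and indep_increments:
      "0 \<le> s 0 \<Longrightarrow> (\<And>i. i < n \<Longrightarrow> s i \<le> s (Suc i)) \<Longrightarrow>
        indep_vars (\<lambda>_. borel) (\<lambda>i \<omega>. S (s (Suc i)) \<omega> - S (s i) \<omega>) {..<n::nat}"
    and stationary_increments: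
      "0 \<le> r \<Longrightarrow> 0 \<le> t \<Longrightarrow>
        distr M borel (\<lambda>\<omega>. S (r + t) \<omega> - S r \<omega>) = distr M borel (S t)"
    and right_continuous_paths:
      "\<omega> \<in> space M \<Longrightarrow> t \<ge> 0 \<Longrightarrow> continuous (at_right t) (\<lambda>s. S s \<omega>)"
    and left_limits_paths:
      "\<omega> \<in> space M \<Longrightarrow> t > 0 \<Longrightarrow> \<exists>l. ((\<lambda>s. S s \<omega>) \<longlongrightarrow> l) (at_left t)"

locale standard_gamma_process = levy_process +
  assumes increasing_paths: "\<omega> \<in> space M \<Longrightarrow> mono_on {0..} (\<lambda>t. S t \<omega>)"
    and laplace_transform:
      "t \<ge> 0 \<Longrightarrow> \<theta> \<ge> 0 \<Longrightarrow> expectation (\<lambda>\<omega>. exp (- \<theta> * S t \<omega>)) = (1 + \<theta>) powr (- t)"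

definition lam :: "real \<Rightarrow> (real \<Rightarrow> real) \<Rightarrow> real" where
  "lam t h = (LBINT x:{0..t}. h x)"

text \<open>
  The pathwise Lebesgue-Stieltjes integral over $(0,t]$. The paths are extended by their value at 0
  to the negative half-line, since \<open>interval_measure\<close> wants a distribution function on all of the
  real line. For nonnegative \<open>h\<close> the integral takes the junk value 0 on paths where it is infinite;
  these form a null set if \<open>h\<close> is locally integrable.
\<close>

definition path_integral ::
  "(real \<Rightarrow> 'a \<Rightarrow> real) \<Rightarrow> real \<Rightarrow> (real \<Rightarrow> real) \<Rightarrow> 'a \<Rightarrow> real" where
  "path_integral S t h \<omega> = (LINT x:{0<..t}|interval_measure (\<lambda>s. S (max 0 s) \<omega>). h x)"

definition vt :: "real \<Rightarrow> (real \<Rightarrow> real) \<Rightarrow> real" where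
  "vt t h = lam t (\<lambda>x. (h x)\<^sup>2) / (lam t h)\<^sup>2"

definition tends_in_probability ::
  "'a measure \<Rightarrow> ('i \<Rightarrow> 'a \<Rightarrow> real) \<Rightarrow> real \<Rightarrow> 'i filter \<Rightarrow> bool" where
  "tends_in_probability M X c F \<longleftrightarrow>
    (\<forall>\<epsilon>>0. ((\<lambda>t. measure M {\<omega> \<in> space M. \<bar>X t \<omega> - c\<bar> > \<epsilon>}) \<longlongrightarrow> 0) F)"

text \<open>
  The Bochner integral of a non-integrable function is 0, so that integrability has to be
  demanded separately.
\<close>

definition tends_in_Lp ::
  "real \<Rightarrow> 'a measure \<Rightarrow> ('i \<Rightarrow> 'a \<Rightarrow> real) \<Rightarrow> real \<Rightarrow> 'i filter \<Rightarrow> bool" where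
  "tends_in_Lp p M X c F \<longleftrightarrow>
    (\<forall>\<^sub>F t in F. X t \<in> borel_measurable M \<and> integrable M (\<lambda>\<omega>. \<bar>X t \<omega> - c\<bar> powr p)) \<and>
    ((\<lambda>t. (\<integral>\<omega>. \<bar>X t \<omega> - c\<bar> powr p \<partial>M)) \<longlongrightarrow> 0) F"

definition orderly_divergence ::
  "'a measure \<Rightarrow> (real \<Rightarrow> 'a \<Rightarrow> real) \<Rightarrow> (real \<Rightarrow> real) \<Rightarrow> bool" where
  "orderly_divergence M S h \<longleftrightarrow>
    tends_in_probability M (\<lambda>t \<omega>. path_integral S t h \<omega> / lam t h) 1 at_top"

definition orderly_divergence_Lp ::
  "real \<Rightarrow> 'a measure \<Rightarrow> (real \<Rightarrow> 'a \<Rightarrow> real) \<Rightarrow> (real \<Rightarrow> real) \<Rightarrow> bool" where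
  "orderly_divergence_Lp p M S h \<longleftrightarrow>
    tends_in_Lp p M (\<lambda>t \<omega>. path_integral S t h \<omega> / lam t h) 1 at_top"

end

theory Submission
  imports Defs
begin

text \<open>
  Write \<open>\<Lambda> t\<close> for the integral of \<open>f\<close> over \<open>(0, t]\<close>. Orderly divergence makes the Laplace
  transforms of \<open>f / \<Lambda> t\<close> converge to that of the constant 1, and for increasing \<open>f\<close> this forces
  \<open>f t / \<Lambda> t\<close> to tend to 0. Comparing successive periods of \<open>g\<close> then bounds the integral of
  \<open>f g\<close> from below by a positive multiple of \<open>\<Lambda> t\<close>, which gives the estimate for \<open>v\<^sub>t\<close> and shows that
  \<open>q = f g / \<lambda>\<^sub>t(f g)\<close> tends to 0 uniformly on \<open>(0, t]\<close>. Since \<open>q\<close> has integral 1 and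
  \<open>- ln (1 - s) = s + O(s\<^sup>2)\<close>, both exponential moments of \<open>\<plusminus>(X - 1)\<close>, where \<open>X\<close> is the
  integral of \<open>q\<close> with respect to \<open>S\<close>, tend to 1; they control every \<open>L\<^sup>p\<close> distance, because
  \<open>\<bar>x\<bar> powr p \<le> \<epsilon> + C (exp x + exp (- x) - 2)\<close>.

  Exponential moments of \<open>\<integral> h dS\<close> for Borel \<open>h\<close> are obtained by approximating \<open>h\<close> in \<open>L\<^sup>1\<close> by
  step functions: the mean of the random measure \<open>dS\<close> is Lebesgue measure, so \<open>L\<^sup>1\<close> convergence of
  the integrands yields \<open>L\<^sup>1\<close> convergence of the integrals.
\<close>

section \<open>Moments of the gamma process\<close>

text \<open>Since \<open>f\<close> is increasing and 0 \<le> g \<le> 1 almost everywhere,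
  \<open>q\<close> is essentially bounded on (0, t] by \<open>f t\<close> over the integral of
  \<open>f g\<close>. So the single fact that f t / \<Lambda> t tends to 0 works twice: it makes the
  incomplete period at the end of (0, t] negligible in the lower bound, and it makes
  \<open>q\<close> uniformly small. Two obstacles shape the rest. The Laplace transform is given for
  \<theta> \<ge> 0 only, whereas controlling the upper tail of X requires E exp (X - 1); the
  transform therefore has to be extended to exponential moments of every order c < 1. And
  \<open>g\<close> is bounded by 1 only off a Lebesgue null set, while dS need not be absolutely
  continuous; a fixed null set still has dS-mass 0 on almost every path, because its expected mass
  is its Lebesgue measure. The passage from step functions to Borel functions is made in two
  strengths: an upper bound by Fatou for positive exponents, and an equality by dominated
  convergence for negative ones, since the argument on f t / \<Lambda> t requires the opposite
  inequality.\<close>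

lemma powser_zero_imp_coeff_zero:
  fixes d :: "nat \<Rightarrow> real"
  assumes "\<And>z. \<bar>z\<bar> < 1 \<Longrightarrow> z \<noteq> 0 \<Longrightarrow> (\<lambda>n. d n * z ^ n) sums 0"
  shows "d n = 0"
  using assms
proof (induction n arbitrary: d)
  case 0
  have "((\<lambda>_. 0) \<longlongrightarrow> d 0) (at (0::real))"
    by (rule powser_limit_0_strong[of 1]) (use 0 in auto)
  then show ?case by (simp add: tendsto_const_iff)
next
  case (Suc n)
  have "((\<lambda>_. 0) \<longlongrightarrow> d 0) (at (0::real))"
    by (rule powser_limit_0_strong[of 1]) (use Suc.prems in auto)
  then have d0: "d 0 = 0" by (simp add: tendsto_const_iff)
  \<comment> \<open>The series is divided by z, which is why the hypothesis leaves out z = 0; the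
    shifted series then satisfies the same hypothesis.\<close>
  have "(\<lambda>n. d (Suc n) * z ^ n) sums 0" if z: "\<bar>z\<bar> < 1" "z \<noteq> 0" for z
  proof -
    have "(\<lambda>n. d (Suc n) * z ^ Suc n) sums 0"
      using Suc.prems[OF z] d0 by (subst sums_Suc_iff) simp
    then have "(\<lambda>n. inverse z * (d (Suc n) * z ^ Suc n)) sums (inverse z * 0)"
      by (rule sums_mult)
    moreover have "inverse z * (d (Suc n) * z ^ Suc n) = d (Suc n) * z ^ n" for n
      using z by (simp add: field_simps)
    ultimately show ?thesis by (simp only: mult_zero_right)
  qed
  then show ?case using Suc.IH[of "\<lambda>n. d (Suc n)"] by blast
qed

lemma powser_coeff_unique:
  fixes a b :: "nat \<Rightarrow> real"
  assumes "\<And>z. \<bar>z\<bar> < 1 \<Longrightarrow> (\<lambda>n. a n * z ^ n) sums f z"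
    and "\<And>z. \<bar>z\<bar> < 1 \<Longrightarrow> (\<lambda>n. b n * z ^ n) sums f z"
  shows "a = b"
proof
  fix n
  have "a n - b n = 0"
  proof (rule powser_zero_imp_coeff_zero[where d = "\<lambda>n. a n - b n"])
    show "(\<lambda>n. (a n - b n) * z ^ n) sums 0" if "\<bar>z\<bar> < 1" "z \<noteq> 0" for z
      using sums_diff[OF assms(1)[of z] assms(2)[of z]] that by (simp add: algebra_simps)
  qed
  then show "a n = b n" by simp
qed

context standard_gamma_process
begin

lemma S_mono: "\<omega> \<in> space M \<Longrightarrow> 0 \<le> s \<Longrightarrow> s \<le> t \<Longrightarrow> S s \<omega> \<le> S t \<omega>"
  using increasing_paths[of \<omega>] by (auto simp: mono_on_def)

lemma S_nonneg: "\<omega> \<in> space M \<Longrightarrow> 0 \<le> t \<Longrightarrow> 0 \<le> S t \<omega>"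
  using S_mono[of \<omega> 0 t] start_zero[of \<omega>] by simp

lemma integrable_exp_neg:
  assumes t: "t \<ge> 0" and c: "c \<le> 0"
  shows "integrable M (\<lambda>\<omega>. exp (c * S t \<omega>))"
proof (rule integrable_const_bound[where B = 1])
  show "AE \<omega> in M. norm (exp (c * S t \<omega>)) \<le> 1"
    using c S_nonneg[OF _ t] by (auto intro!: AE_I2 simp: mult_nonpos_nonneg)
qed (use random_variable_S[OF t] in measurable)

text \<open>For fixed \<omega> the \<open>m n \<omega>\<close> are Poisson weights with parameter
  \<open>S t \<omega>\<close>: nonnegative with sum 1, hence bounded by 1 and integrable before
  anything is known about the moments of \<open>S t\<close>. Their generating function in z is exp
  ((z - 1) S t), whose expectation is the Laplace transform at \<theta> = 1 - z, so the coefficients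
  can be compared.\<close>

lemma moments:
  fixes t :: real
  assumes t: "t \<ge> 0"
  defines "m \<equiv> \<lambda>n \<omega>. exp (- S t \<omega>) * S t \<omega> ^ n / fact n"
  shows "integrable M (m n)"
    and "expectation (m n) = 2 powr (- t) * ((- t) gchoose n) * (- 1 / 2) ^ n"
proof -
  have [measurable]: "S t \<in> borel_measurable M" using random_variable_S[OF t] .
  have m_nonneg: "m k \<omega> \<ge> 0" if "\<omega> \<in> space M" for k \<omega>
    using S_nonneg[OF that t] by (simp add: m_def)
  have m_sums: "(\<lambda>k. m k \<omega> * z ^ k) sums exp ((z - 1) * S t \<omega>)" for \<omega> z
  proof -
    have "(\<lambda>k. exp (- S t \<omega>) * ((z * S t \<omega>) ^ k / fact k)) sums (exp (- S t \<omega>) * exp (z * S t \<omega>))"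
      using exp_converges[of "z * S t \<omega>"] by (intro sums_mult) (simp add: divide_inverse mult.commute)
    then show ?thesis
      by (simp add: m_def exp_add[symmetric] algebra_simps power_mult_distrib)
  qed
  have part: "(\<Sum>k<n. m k \<omega>) \<le> 1" if "\<omega> \<in> space M" for n \<omega>
    using sum_le_suminf[of "\<lambda>k. m k \<omega>" "{..<n}"] m_sums[of \<omega> 1] m_nonneg[OF that]
    by (auto simp: sums_iff)
  have m_le: "m k \<omega> \<le> 1" if "\<omega> \<in> space M" for k \<omega>
    using part[OF that, of "Suc k"] sum_nonneg[of "{..<k}" "\<lambda>k. m k \<omega>"] m_nonneg[OF that] by simp
  have int: "integrable M (m k)" for k
    by (rule integrable_const_bound[where B = 1])
      (use m_nonneg m_le in \<open>auto intro!: AE_I2 simp: abs_of_nonneg\<close>, simp add: m_def[abs_def])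
  then show "integrable M (m n)" .
  have Em_sum: "summable (\<lambda>k. expectation (m k))"
  proof (rule summableI_nonneg_bounded)
    show "0 \<le> expectation (m k)" for k
      using m_nonneg by (intro integral_nonneg_AE) auto
    show "(\<Sum>k<n. expectation (m k)) \<le> 1" for n
    proof -
      have "(\<Sum>k<n. expectation (m k)) = expectation (\<lambda>\<omega>. \<Sum>k<n. m k \<omega>)"
        using int by simp
      also have "\<dots> \<le> expectation (\<lambda>_. 1)"
        using int part by (intro integral_mono) auto
      finally show ?thesis by (simp add: prob_space)
    qed
  qed
  have sums1: "(\<lambda>k. expectation (m k) * z ^ k) sums ((2 - z) powr (- t))" if z: "\<bar>z\<bar> < 1" for z
  proof -
    have "(\<lambda>k. expectation (\<lambda>\<omega>. m k \<omega> * z ^ k)) sums expectation (\<lambda>\<omega>. \<Sum>k. m k \<omega> * z ^ k)"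
    proof (rule sums_integral)
      show "integrable M (\<lambda>\<omega>. m k \<omega> * z ^ k)" for k using int by simp
      show "AE \<omega> in M. summable (\<lambda>k. norm (m k \<omega> * z ^ k))"
      proof (rule AE_I2)
        fix \<omega> assume "\<omega> \<in> space M"
        then have "norm (m k \<omega> * z ^ k) = m k \<omega> * \<bar>z\<bar> ^ k" for k
          using m_nonneg by (simp add: abs_mult power_abs)
        then show "summable (\<lambda>k. norm (m k \<omega> * z ^ k))"
          using m_sums[of \<omega> "\<bar>z\<bar>"] by (simp add: sums_iff)
      qed
      show "summable (\<lambda>k. expectation (\<lambda>\<omega>. norm (m k \<omega> * z ^ k)))"
      proof (rule summable_comparison_test'[OF Em_sum, of 0])
        fix k :: nat
        have "norm (expectation (\<lambda>\<omega>. norm (m k \<omega> * z ^ k))) = expectation (\<lambda>\<omega>. norm (m k \<omega> * z ^ k))"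
          by simp
        also have "\<dots> \<le> expectation (m k)"
        proof (rule integral_mono)
          show "norm (m k \<omega> * z ^ k) \<le> m k \<omega>" if "\<omega> \<in> space M" for \<omega>
            using m_nonneg[OF that, of k] z power_le_one[of "\<bar>z\<bar>" k]
            by (simp add: abs_mult power_abs mult_left_le)
        qed (use int in auto)
        finally show "norm (expectation (\<lambda>\<omega>. norm (m k \<omega> * z ^ k))) \<le> expectation (m k)" .
      qed
    qed
    moreover have "(\<Sum>k. m k \<omega> * z ^ k) = exp (- (1 - z) * S t \<omega>)" for \<omega>
      using m_sums[of \<omega> z] by (simp add: sums_iff algebra_simps)
    moreover have "expectation (\<lambda>\<omega>. exp (- (1 - z) * S t \<omega>)) = (2 - z) powr (- t)"
      using laplace_transform[OF t, of "1 - z"] z by (simp add: algebra_simps)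
    ultimately show ?thesis by simp
  qed
  \<comment> \<open>Binomial expansion of 2^(-t) (1 - z/2)^(-t). Its radius of convergence is 2,
    which leaves room beyond z = 1.\<close>
  have sums2: "(\<lambda>k. (2 powr (- t) * ((- t) gchoose k) * (- 1 / 2) ^ k) * z ^ k) sums ((2 - z) powr (- t))"
    if z: "\<bar>z\<bar> < 1" for z
  proof -
    have "(\<lambda>k. 2 powr (- t) * (((- t) gchoose k) * (- z / 2) ^ k)) sums
        (2 powr (- t) * (1 + (- z / 2)) powr (- t))"
      using z by (intro sums_mult gen_binomial_real) auto
    also have "2 powr (- t) * (1 + (- z / 2)) powr (- t) = (2 - z) powr (- t)"
      using z by (simp add: powr_mult[symmetric] algebra_simps)
    finally have *: "(\<lambda>k. 2 powr (- t) * (((- t) gchoose k) * (- z / 2) ^ k)) sums ((2 - z) powr (- t))" .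
    have "(- z / 2) ^ k = (- 1 / 2) ^ k * z ^ k" for k
      by (simp add: power_mult_distrib[symmetric])
    with * show ?thesis by (simp only: mult.assoc)
  qed
  show "expectation (m n) = 2 powr (- t) * ((- t) gchoose n) * (- 1 / 2) ^ n"
    using powser_coeff_unique[OF sums1 sums2] by (rule fun_cong)
qed

text \<open>
  For positive \<open>c\<close> the moment generating function is not part of the hypotheses: the Laplace
  transform is expanded at 1, where its Taylor coefficients are moments with nonnegative
  integrands, and the series is summed beyond 0.
\<close>

lemma mgf:
  assumes t: "t \<ge> 0" and c: "c < 1"
  shows "integrable M (\<lambda>\<omega>. exp (c * S t \<omega>))"
    and "expectation (\<lambda>\<omega>. exp (c * S t \<omega>)) = (1 - c) powr (- t)"
proof -
  have "integrable M (\<lambda>\<omega>. exp (c * S t \<omega>)) \<and>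
    expectation (\<lambda>\<omega>. exp (c * S t \<omega>)) = (1 - c) powr (- t)"
  proof (cases "c \<le> 0")
    case True
    then show ?thesis
      using integrable_exp_neg[OF t True] laplace_transform[OF t, of "- c"] by simp
  next
    case False
    define m where "m n \<omega> = exp (- S t \<omega>) * S t \<omega> ^ n / fact n" for n \<omega>
    have int: "integrable M (m n)" and
      E: "expectation (m n) = 2 powr (- t) * ((- t) gchoose n) * (- 1 / 2) ^ n" for n
      using moments[OF t, of n] by (simp_all add: m_def[abs_def])
    have m_sums: "(\<lambda>k. m k \<omega> * (1 + c) ^ k) sums exp (c * S t \<omega>)" for \<omega>
    proof -
      have "(\<lambda>k. exp (- S t \<omega>) * (((1 + c) * S t \<omega>) ^ k / fact k)) sums
          (exp (- S t \<omega>) * exp ((1 + c) * S t \<omega>))"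
        using exp_converges[of "(1 + c) * S t \<omega>"]
        by (intro sums_mult) (simp add: divide_inverse mult.commute)
      also have "exp (- S t \<omega>) * exp ((1 + c) * S t \<omega>) = exp (c * S t \<omega>)"
        by (simp add: exp_add[symmetric] algebra_simps)
      finally show ?thesis by (simp add: m_def power_mult_distrib mult_ac)
    qed
    have nn: "m k \<omega> * (1 + c) ^ k \<ge> 0" if "\<omega> \<in> space M" for k \<omega>
      using S_nonneg[OF that t] False by (simp add: m_def)
    \<comment> \<open>The binomial series at z = 1 + c, a point of (1, 2). As c > 0, all terms are
      nonnegative, so convergence of this numerical series is already the absolute summability that
      allows sum and expectation to be exchanged.\<close>
    have sums2: "(\<lambda>k. expectation (m k) * (1 + c) ^ k) sums ((1 - c) powr (- t))"
    proof -
      have "(\<lambda>k. 2 powr (- t) * (((- t) gchoose k) * (- (1 + c) / 2) ^ k)) sums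
          (2 powr (- t) * (1 + (- (1 + c) / 2)) powr (- t))"
        using c False by (intro sums_mult gen_binomial_real) auto
      also have "2 powr (- t) * (1 + (- (1 + c) / 2)) powr (- t) = (1 - c) powr (- t)"
        using c by (simp add: powr_mult[symmetric] add_divide_distrib diff_divide_distrib algebra_simps)
      finally have *: "(\<lambda>k. 2 powr (- t) * (((- t) gchoose k) * (- (1 + c) / 2) ^ k)) sums
        ((1 - c) powr (- t))" .
      have "(- (1 + c) / 2) ^ k = (- 1 / 2) ^ k * (1 + c) ^ k" for k
        by (simp add: power_mult_distrib[symmetric] add_divide_distrib diff_divide_distrib)
      with * show ?thesis by (simp only: mult.assoc E)
    qed
    have 1: "AE \<omega> in M. summable (\<lambda>k. norm (m k \<omega> * (1 + c) ^ k))"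
      using m_sums nn by (intro AE_I2) (auto simp: sums_iff)
    have 2: "expectation (\<lambda>\<omega>. norm (m k \<omega> * (1 + c) ^ k)) = expectation (m k) * (1 + c) ^ k" for k
    proof -
      have "expectation (\<lambda>\<omega>. norm (m k \<omega> * (1 + c) ^ k)) = expectation (\<lambda>\<omega>. m k \<omega> * (1 + c) ^ k)"
        using nn by (intro Bochner_Integration.integral_cong) auto
      then show ?thesis by simp
    qed
    have 3: "summable (\<lambda>k. expectation (\<lambda>\<omega>. norm (m k \<omega> * (1 + c) ^ k)))"
      using sums2 unfolding 2 by (simp add: sums_iff)
    have 4: "integrable M (\<lambda>\<omega>. m k \<omega> * (1 + c) ^ k)" for k using int by simp
    have S: "(\<Sum>k. m k \<omega> * (1 + c) ^ k) = exp (c * S t \<omega>)" for \<omega>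
      using m_sums by (simp add: sums_iff)
    show ?thesis
      using integrable_suminf[OF 4 1 3] sums_integral[OF 4 1 3] sums2
      unfolding S by (auto intro: sums_unique2)
  qed
  then show "integrable M (\<lambda>\<omega>. exp (c * S t \<omega>))"
    and "expectation (\<lambda>\<omega>. exp (c * S t \<omega>)) = (1 - c) powr (- t)" by auto
qed

lemma mean:
  assumes t: "t \<ge> 0"
  shows "integrable M (S t)" and "expectation (S t) = t"
proof -
  show int: "integrable M (S t)"
  proof (rule Bochner_Integration.integrable_bound)
    show "integrable M (\<lambda>\<omega>. 2 * exp ((1 / 2) * S t \<omega>))" using mgf(1)[OF t, of "1/2"] by simp
    show "AE \<omega> in M. norm (S t \<omega>) \<le> norm (2 * exp ((1 / 2) * S t \<omega>))"
    proof (rule AE_I2)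
      fix \<omega> assume "\<omega> \<in> space M"
      then show "norm (S t \<omega>) \<le> norm (2 * exp ((1 / 2) * S t \<omega>))"
        using S_nonneg[of \<omega> t] t exp_ge_add_one_self[of "(1/2) * S t \<omega>"] by (simp add: field_simps)
    qed
  qed (use random_variable_S[OF t] in measurable)
  have der: "((\<lambda>c. (1 - c) powr (- t)) has_real_derivative t) (at 0)"
    by (auto intro!: derivative_eq_intros)
  have le: "c * expectation (S t) \<le> (1 - c) powr (- t) - 1" if "c < 1" for c
  proof -
    have "expectation (\<lambda>\<omega>. c * S t \<omega> + 1) \<le> expectation (\<lambda>\<omega>. exp (c * S t \<omega>))"
      using int mgf(1)[OF t that] exp_ge_add_one_self by (intro integral_mono) (auto simp: add.commute)
    then show ?thesis using int mgf(2)[OF t that] by (simp add: prob_space)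
  qed
  have "((\<lambda>c. ((1 - c) powr (- t) - 1) / c) \<longlongrightarrow> t) (at 0)"
    using der by (simp add: has_field_derivative_iff)
  then have R: "((\<lambda>c. ((1 - c) powr (- t) - 1) / c) \<longlongrightarrow> t) (at_right 0)"
    and L: "((\<lambda>c. ((1 - c) powr (- t) - 1) / c) \<longlongrightarrow> t) (at_left 0)"
    by (auto simp: filterlim_split_at_real filterlim_at_split)
  have "expectation (S t) \<le> t"
  proof (rule tendsto_lowerbound[OF R])
    show "\<forall>\<^sub>F c in at_right 0. expectation (S t) \<le> ((1 - c) powr (- t) - 1) / c"
      unfolding eventually_at_right_field
      by (rule exI[of _ 1]) (use le in \<open>auto simp: pos_le_divide_eq mult.commute\<close>)
  qed simp
  moreover have "t \<le> expectation (S t)"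
  proof (rule tendsto_upperbound[OF L])
    show "\<forall>\<^sub>F c in at_left 0. ((1 - c) powr (- t) - 1) / c \<le> expectation (S t)"
      unfolding eventually_at_left_field
      by (rule exI[of _ "-1"]) (use le in \<open>auto simp: neg_divide_le_eq mult.commute\<close>)
  qed simp
  ultimately show "expectation (S t) = t" by simp
qed

end

section \<open>The random measure\<close>

lemma integral_density_indicator:
  fixes h :: "'b \<Rightarrow> real"
  assumes "h \<in> borel_measurable N" "A \<in> sets N"
  shows "(\<integral>x. h x \<partial>density N (indicator A)) = (LINT x:A|N. h x)"
proof -
  have "density N (indicator A) = density N (\<lambda>x. ennreal (indicat_real A x))"
    by (simp add: ennreal_indicator)
  then show ?thesis
    using assms by (simp add: integral_density set_lebesgue_integral_def)
qed

section \<open>Lebesgue measure on (0, t]\<close>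

text \<open>A finite measure on the whole line with the Borel sets, parallel to
  \<open>jump_measure\<close>, so that the same statement on step functions serves both. It is
  half-open like the domain of \<open>path_integral\<close>, and the zero measure if t \<le>
  0.\<close>

definition leb :: "real \<Rightarrow> real measure" where
  "leb t = density lborel (indicator {0<..t})"

lemma sets_leb [simp, measurable_cong]: "sets (leb t) = sets borel"
  by (simp add: leb_def)

lemma space_leb [simp]: "space (leb t) = UNIV"
  by (simp add: leb_def)

lemma AE_leb: "(AE x in leb t. P x) \<longleftrightarrow> (AE x in lborel. 0 < x \<and> x \<le> t \<longrightarrow> P x)"
  unfolding leb_def by (subst AE_density) (auto simp: indicator_def)

lemma AE_leb_Ioc: "AE x in leb t. 0 < x \<and> x \<le> t"
  by (simp add: AE_leb)

lemma emeasure_leb: "A \<in> sets borel \<Longrightarrow> emeasure (leb t) A = emeasure lborel (A \<inter> {0<..t})"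
  unfolding leb_def
  by (subst emeasure_density) (auto intro!: nn_integral_cong simp: indicator_def
      simp flip: nn_integral_indicator)

lemma finite_measure_leb: "finite_measure (leb t)"
  by (rule finite_measureI) (cases "0 \<le> t"; simp add: emeasure_leb)

interpretation leb: finite_measure "leb t" for t
  by (rule finite_measure_leb)

lemma integral_leb:
  fixes h :: "real \<Rightarrow> real"
  assumes "h \<in> borel_measurable borel"
  shows "(\<integral>x. h x \<partial>leb t) = (LBINT x:{0<..t}. h x)"
  unfolding leb_def using assms by (intro integral_density_indicator) auto

lemma lam_eq_integral_leb:
  assumes [measurable]: "h \<in> borel_measurable borel"
    and eq: "\<And>x. 0 < x \<Longrightarrow> x \<le> t \<Longrightarrow> k x = h x"
  shows "lam t k = (\<integral>x. h x \<partial>leb t)"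
proof -
  have "lam t k = (LBINT x:{0<..t}. h x)"
    unfolding lam_def set_lebesgue_integral_def
  proof (rule integral_cong_AE)
    \<comment> \<open>\<open>k\<close> is not assumed measurable and its value at 0 is arbitrary.
      Splitting off the point 0 shows the integrand to be measurable; the point itself is a null
      set.\<close>
    have "indicat_real {0..t} x *\<^sub>R k x =
        indicat_real {0<..t} x *\<^sub>R h x + indicat_real ({0} \<inter> {0..t}) x *\<^sub>R k 0" for x
      using eq[of x] by (cases "x = 0") (auto simp: indicator_def)
    then show "(\<lambda>x. indicat_real {0..t} x *\<^sub>R k x) \<in> borel_measurable lborel"
      by simp
    show "AE x in lborel. indicat_real {0..t} x *\<^sub>R k x = indicat_real {0<..t} x *\<^sub>R h x"
      using AE_lborel_singleton[of 0] by eventually_elim (auto simp: indicator_def eq)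
  qed simp
  then show ?thesis by (simp add: integral_leb)
qed

section \<open>The measure of a path and its mean\<close>

context standard_gamma_process
begin

text \<open>The measure dS of one path, cut down to (0, t]. For t \<ge> 0 and \<omega> in
  \<open>space M\<close> it has finite total mass \<open>S t \<omega>\<close>, so bounded Borel
  functions are integrable along every path.\<close>

definition jump_measure :: "real \<Rightarrow> 'a \<Rightarrow> real measure" where
  "jump_measure t \<omega> = density (interval_measure (\<lambda>s. S (max 0 s) \<omega>)) (indicator {0<..t})"

lemma sets_jump_measure [simp, measurable_cong]: "sets (jump_measure t \<omega>) = sets borel"
  by (simp add: jump_measure_def)

lemma space_jump_measure [simp]: "space (jump_measure t \<omega>) = UNIV"
  by (simp add: jump_measure_def)

lemma emeasure_interval_measure_S:
  assumes \<omega>: "\<omega> \<in> space M" and "0 \<le> a" "a \<le> b"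
  shows "emeasure (interval_measure (\<lambda>s. S (max 0 s) \<omega>)) {a<..b} = ennreal (S b \<omega> - S a \<omega>)"
proof -
  have "continuous (at_right a) (\<lambda>s. S (max 0 s) \<omega>)" for a
  proof (cases "a \<ge> 0")
    case True
    have "((\<lambda>s. S s \<omega>) \<longlongrightarrow> S a \<omega>) (at_right a)"
      using right_continuous_paths[OF \<omega> True] by (simp add: continuous_within)
    then have "((\<lambda>s. S (max 0 s) \<omega>) \<longlongrightarrow> S a \<omega>) (at_right a)"
      by (rule Lim_transform_eventually)
        (use True in \<open>auto simp: eventually_at_filter max_def\<close>)
    then show ?thesis using True by (simp add: continuous_within max_def)
  next
    case False
    have "((\<lambda>s. S (max 0 s) \<omega>) \<longlongrightarrow> S 0 \<omega>) (at_right a)"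
    proof (rule tendsto_eventually)
      show "\<forall>\<^sub>F s in at_right a. S (max 0 s) \<omega> = S 0 \<omega>"
        unfolding eventually_at_right_field by (rule exI[of _ 0]) (use False in auto)
    qed
    then show ?thesis using False by (simp add: continuous_within max_def)
  qed
  then have "emeasure (interval_measure (\<lambda>s. S (max 0 s) \<omega>)) {a<..b} =
      ennreal (S (max 0 b) \<omega> - S (max 0 a) \<omega>)"
    using assms by (intro emeasure_interval_measure_Ioc) (auto intro!: S_mono)
  then show ?thesis using assms by (simp add: max_def)
qed

lemma emeasure_jump_measure:
  "A \<in> sets borel \<Longrightarrow> emeasure (jump_measure t \<omega>) A =
    emeasure (interval_measure (\<lambda>s. S (max 0 s) \<omega>)) (A \<inter> {0<..t})"
  unfolding jump_measure_def
  by (subst emeasure_density) (auto intro!: nn_integral_cong simp: indicator_def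
      simp flip: nn_integral_indicator)

lemma emeasure_jump_measure_Ioc:
  assumes "\<omega> \<in> space M" "0 \<le> a" "a \<le> b" "b \<le> t"
  shows "emeasure (jump_measure t \<omega>) {a<..b} = ennreal (S b \<omega> - S a \<omega>)"
proof -
  have "{a<..b} \<inter> {0<..t} = {a<..b}" using assms by auto
  then show ?thesis using assms by (simp add: emeasure_jump_measure emeasure_interval_measure_S)
qed

lemma emeasure_jump_measure_atMost:
  assumes "\<omega> \<in> space M" "0 \<le> t"
  shows "emeasure (jump_measure t \<omega>) {..a} = ennreal (S (min t (max 0 a)) \<omega>)"
proof -
  have "{..a} \<inter> {0<..t} = {0<..min t (max 0 a)}" using assms by auto
  then show ?thesis
    using assms by (simp add: emeasure_jump_measure emeasure_interval_measure_S start_zero)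
qed

lemma emeasure_jump_measure_UNIV:
  assumes "\<omega> \<in> space M" "0 \<le> t"
  shows "emeasure (jump_measure t \<omega>) UNIV = ennreal (S t \<omega>)"
  using assms by (simp add: emeasure_jump_measure emeasure_interval_measure_S start_zero)

lemma finite_measure_jump_measure:
  "\<omega> \<in> space M \<Longrightarrow> 0 \<le> t \<Longrightarrow> finite_measure (jump_measure t \<omega>)"
  by (rule finite_measureI) (simp add: emeasure_jump_measure_UNIV)

lemma AE_jump_measure_Ioc: "AE x in jump_measure t \<omega>. 0 < x \<and> x \<le> t"
  unfolding jump_measure_def by (subst AE_density) (auto simp: indicator_def)

lemma path_integral_eq:
  assumes [measurable]: "h \<in> borel_measurable borel"
    and "\<And>x. 0 < x \<Longrightarrow> x \<le> t \<Longrightarrow> k x = h x"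
  shows "path_integral S t k \<omega> = (\<integral>x. h x \<partial>jump_measure t \<omega>)"
proof -
  have "path_integral S t k \<omega> = (LINT x:{0<..t}|interval_measure (\<lambda>s. S (max 0 s) \<omega>). h x)"
    unfolding path_integral_def set_lebesgue_integral_def
    using assms(2) by (intro Bochner_Integration.integral_cong) (auto simp: indicator_def)
  then show ?thesis
    unfolding jump_measure_def by (subst integral_density_indicator) auto
qed

lemma expectation_S_ennreal: "0 \<le> t \<Longrightarrow> (\<integral>\<^sup>+\<omega>. ennreal (S t \<omega>) \<partial>M) = ennreal t"
  using mean[of t] S_nonneg[of _ t] by (subst nn_integral_eq_integral) auto

text \<open>A Dynkin argument from the half-lines {..a}, whose mass is \<open>S\<close> at the time
  a clipped to [0, t]; \<open>mean\<close> supplies its expectation. Measurability and mean value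
  are carried through the induction together, because subtracting and summing expectations requires
  measurability of the parts.\<close>

lemma jump_measure_kernel_set:
  assumes t: "0 \<le> t" and A: "A \<in> sets borel"
  shows "(\<lambda>\<omega>. emeasure (jump_measure t \<omega>) A) \<in> borel_measurable M \<and>
    (\<integral>\<^sup>+\<omega>. emeasure (jump_measure t \<omega>) A \<partial>M) = emeasure (leb t) A"
proof -
  let ?G = "range (\<lambda>a::real. {..a})"
  have [measurable]: "S s \<in> borel_measurable M" if "s \<ge> 0" for s
    using random_variable_S[OF that] .
  have borel: "sets borel = sigma_sets UNIV ?G" by (simp add: borel_eq_atMost)
  have U: "(\<lambda>\<omega>. emeasure (jump_measure t \<omega>) UNIV) \<in> borel_measurable M"
    using t by (subst measurable_cong[OF emeasure_jump_measure_UNIV]) auto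
  have EU: "(\<integral>\<^sup>+\<omega>. emeasure (jump_measure t \<omega>) UNIV \<partial>M) = emeasure (leb t) UNIV"
    using t by (subst nn_integral_cong[OF emeasure_jump_measure_UNIV])
      (auto simp: expectation_S_ennreal emeasure_leb)
  have "Int_stable ?G" by (auto simp: Int_stable_def)
  moreover have "?G \<subseteq> Pow UNIV" by auto
  moreover have "A \<in> sigma_sets UNIV ?G" using A borel by simp
  ultimately show ?thesis
  proof (induction rule: sigma_sets_induct_disjoint)
    case (basic A)
    then obtain a where A: "A = {..a}" by auto
    have eq: "{..a} \<inter> {0<..t} = {0<..min t (max 0 a)}" using t by auto
    show ?case
      unfolding A
      using t by (subst measurable_cong[OF emeasure_jump_measure_atMost],
          (simp_all)[2], subst nn_integral_cong[OF emeasure_jump_measure_atMost])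
        (auto simp: expectation_S_ennreal emeasure_leb eq)
  next
    case empty
    then show ?case by simp
  next
    case (compl A)
    then have A: "A \<in> sets borel" using borel by simp
    have [measurable]: "(\<lambda>\<omega>. emeasure (jump_measure t \<omega>) A) \<in> borel_measurable M"
      using compl by simp
    note U[measurable]
    have le: "emeasure (jump_measure t \<omega>) A \<le> emeasure (jump_measure t \<omega>) UNIV" for \<omega>
      using A by (intro emeasure_mono) auto
    have eq: "emeasure (jump_measure t \<omega>) (UNIV - A) =
        emeasure (jump_measure t \<omega>) UNIV - emeasure (jump_measure t \<omega>) A" if "\<omega> \<in> space M" for \<omega>
    proof (rule emeasure_Diff)
      have "emeasure (jump_measure t \<omega>) A < \<top>"
        using le[of \<omega>] that t by (simp add: emeasure_jump_measure_UNIV order_le_less_trans)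
      then show "emeasure (jump_measure t \<omega>) A \<noteq> \<infinity>" by simp
    qed (use A in auto)
    have "(\<integral>\<^sup>+\<omega>. emeasure (jump_measure t \<omega>) (UNIV - A) \<partial>M) =
        (\<integral>\<^sup>+\<omega>. emeasure (jump_measure t \<omega>) UNIV - emeasure (jump_measure t \<omega>) A \<partial>M)"
      by (intro nn_integral_cong eq)
    also have "\<dots> = (\<integral>\<^sup>+\<omega>. emeasure (jump_measure t \<omega>) UNIV \<partial>M) - (\<integral>\<^sup>+\<omega>. emeasure (jump_measure t \<omega>) A \<partial>M)"
      using compl le leb.emeasure_finite[of t A] by (intro nn_integral_diff) auto
    also have "\<dots> = emeasure (leb t) UNIV - emeasure (leb t) A" using compl EU by simp
    also have "\<dots> = emeasure (leb t) (UNIV - A)"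
      using A by (intro emeasure_Diff[symmetric]) auto
    finally show ?case by (subst measurable_cong[OF eq]) auto
  next
    case (union A)
    then have A: "A i \<in> sets borel" for i using borel by auto
    have [measurable]: "(\<lambda>\<omega>. emeasure (jump_measure t \<omega>) (A i)) \<in> borel_measurable M" for i
      using union by simp
    have eq: "emeasure (jump_measure t \<omega>) (\<Union>i. A i) = (\<Sum>i. emeasure (jump_measure t \<omega>) (A i))" for \<omega>
      using A union by (intro suminf_emeasure[symmetric]) auto
    have "(\<Sum>i. emeasure (leb t) (A i)) = emeasure (leb t) (\<Union>i. A i)"
      using A union by (intro suminf_emeasure) auto
    then show ?case
      unfolding eq using union by (subst nn_integral_suminf) auto
  qed
qed

text \<open>Campbell's formula: integration against the random measure, averaged over \<omega>, is
  integration against its mean.\<close>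

lemma jump_measure_kernel:
  assumes t: "0 \<le> t" and u: "u \<in> borel_measurable borel"
  shows "(\<lambda>\<omega>. \<integral>\<^sup>+x. u x \<partial>jump_measure t \<omega>) \<in> borel_measurable M \<and>
    (\<integral>\<^sup>+\<omega>. \<integral>\<^sup>+x. u x \<partial>jump_measure t \<omega> \<partial>M) = (\<integral>\<^sup>+x. u x \<partial>leb t)"
  using u
proof (induction rule: borel_measurable_induct)
  case (cong f g)
  then have "f = g" by auto
  then show ?case using cong by simp
next
  case (set A)
  then show ?case using jump_measure_kernel_set[OF t] by simp
next
  case (mult u c)
  then show ?case by (auto simp: nn_integral_cmult)
next
  case (add u v)
  then show ?case by (auto simp: nn_integral_add)
next
  case (seq U)
  note [measurable] = seq(1)
  have inc: "incseq (\<lambda>i \<omega>. \<integral>\<^sup>+x. U i x \<partial>jump_measure t \<omega>)"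
    using \<open>incseq U\<close> by (auto simp: incseq_def le_fun_def intro!: nn_integral_mono)
  have eq: "(\<integral>\<^sup>+x. (SUP i. U i) x \<partial>jump_measure t \<omega>) = (SUP i. \<integral>\<^sup>+x. U i x \<partial>jump_measure t \<omega>)" for \<omega>
    using seq unfolding SUP_apply by (subst nn_integral_monotone_convergence_SUP) auto
  have eq': "(\<integral>\<^sup>+x. (SUP i. U i) x \<partial>leb t) = (SUP i. \<integral>\<^sup>+x. U i x \<partial>leb t)"
    using seq unfolding SUP_apply by (subst nn_integral_monotone_convergence_SUP) auto
  have [measurable]: "(\<lambda>\<omega>. \<integral>\<^sup>+x. U i x \<partial>jump_measure t \<omega>) \<in> borel_measurable M" for i
    using seq by simp
  show ?case
    unfolding eq eq' using seq inc by (subst nn_integral_monotone_convergence_SUP) auto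
qed

lemma measurable_integral_jump_measure:
  fixes h :: "real \<Rightarrow> real"
  assumes t: "0 \<le> t" and [measurable]: "h \<in> borel_measurable borel" and nn: "\<And>x. h x \<ge> 0"
  shows "(\<lambda>\<omega>. \<integral>x. h x \<partial>jump_measure t \<omega>) \<in> borel_measurable M"
  using jump_measure_kernel[OF t, of "\<lambda>x. ennreal (h x)"] nn
  by (auto simp: integral_eq_nn_integral)

text \<open>The exceptional set has expected dS-mass 0, hence mass 0 on almost every path. This
  transfers g \<le> 1 from almost every point to almost every path.\<close>

lemma AE_jump_measure:
  assumes t: "0 \<le> t" and P: "Measurable.pred borel P" and AE: "AE x in leb t. P x"
  shows "AE \<omega> in M. AE x in jump_measure t \<omega>. P x"
proof -
  note [measurable] = P
  have A: "{x. \<not> P x} \<in> sets borel" by measurable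
  have "emeasure (leb t) {x. \<not> P x} = 0"
    using AE by (subst (asm) AE_iff_measurable[OF _ refl]) auto
  then have "AE \<omega> in M. emeasure (jump_measure t \<omega>) {x. \<not> P x} = 0"
    using jump_measure_kernel_set[OF t A] by (auto simp: nn_integral_0_iff_AE)
  then show ?thesis
    by eventually_elim (auto intro!: AE_I[where N = "{x. \<not> P x}"])
qed

text \<open>Boundedness makes the integral of a signed function finite on every path. The identity
  for \<bar>h\<bar> turns an L^1 error of integrands into an L^1 error of random integrals.\<close>

lemma integral_jump_measure:
  fixes h :: "real \<Rightarrow> real"
  assumes t: "0 \<le> t" and [measurable]: "h \<in> borel_measurable borel" and b: "\<And>x. \<bar>h x\<bar> \<le> B"
  shows "(\<lambda>\<omega>. \<integral>x. h x \<partial>jump_measure t \<omega>) \<in> borel_measurable M"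
    and "integrable M (\<lambda>\<omega>. \<integral>x. \<bar>h x\<bar> \<partial>jump_measure t \<omega>)"
    and "expectation (\<lambda>\<omega>. \<integral>x. \<bar>h x\<bar> \<partial>jump_measure t \<omega>) = (\<integral>x. \<bar>h x\<bar> \<partial>leb t)"
    and "integrable M (\<lambda>\<omega>. \<integral>x. h x \<partial>jump_measure t \<omega>)"
proof -
  have int: "integrable (jump_measure t \<omega>) h" if "\<omega> \<in> space M" for \<omega>
    using b by (intro finite_measure.integrable_const_bound[OF finite_measure_jump_measure[OF that t]]) auto
  have split: "(\<integral>x. h x \<partial>jump_measure t \<omega>) =
      (\<integral>x. max 0 (h x) \<partial>jump_measure t \<omega>) - (\<integral>x. max 0 (- h x) \<partial>jump_measure t \<omega>)"
    if "\<omega> \<in> space M" for \<omega>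
  proof -
    have "(\<integral>x. h x \<partial>jump_measure t \<omega>) = (\<integral>x. max 0 (h x) - max 0 (- h x) \<partial>jump_measure t \<omega>)"
      by (intro Bochner_Integration.integral_cong) auto
    then show ?thesis using int[OF that] by simp
  qed
  show meas: "(\<lambda>\<omega>. \<integral>x. h x \<partial>jump_measure t \<omega>) \<in> borel_measurable M"
    by (subst measurable_cong[OF split])
      (auto intro!: borel_measurable_diff measurable_integral_jump_measure[OF t])
  have meas_abs[measurable]: "(\<lambda>\<omega>. \<integral>x. \<bar>h x\<bar> \<partial>jump_measure t \<omega>) \<in> borel_measurable M"
    by (auto intro!: measurable_integral_jump_measure[OF t])
  have intl: "integrable (leb t) h"
    using b by (intro leb.integrable_const_bound) auto
  have "(\<integral>\<^sup>+\<omega>. ennreal (\<integral>x. \<bar>h x\<bar> \<partial>jump_measure t \<omega>) \<partial>M) =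
      (\<integral>\<^sup>+\<omega>. \<integral>\<^sup>+x. ennreal \<bar>h x\<bar> \<partial>jump_measure t \<omega> \<partial>M)"
    using int by (intro nn_integral_cong nn_integral_eq_integral[symmetric]) auto
  also have "\<dots> = (\<integral>\<^sup>+x. ennreal \<bar>h x\<bar> \<partial>leb t)"
    using jump_measure_kernel[OF t, of "\<lambda>x. ennreal \<bar>h x\<bar>"] by simp
  also have "\<dots> = ennreal (\<integral>x. \<bar>h x\<bar> \<partial>leb t)"
    using intl by (intro nn_integral_eq_integral) auto
  finally have *: "(\<integral>\<^sup>+\<omega>. ennreal (\<integral>x. \<bar>h x\<bar> \<partial>jump_measure t \<omega>) \<partial>M) = ennreal (\<integral>x. \<bar>h x\<bar> \<partial>leb t)" .
  show int_abs: "integrable M (\<lambda>\<omega>. \<integral>x. \<bar>h x\<bar> \<partial>jump_measure t \<omega>)"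
    using * by (intro integrableI_nonneg) auto
  show "expectation (\<lambda>\<omega>. \<integral>x. \<bar>h x\<bar> \<partial>jump_measure t \<omega>) = (\<integral>x. \<bar>h x\<bar> \<partial>leb t)"
    using * by (subst integral_eq_nn_integral) auto
  show "integrable M (\<lambda>\<omega>. \<integral>x. h x \<partial>jump_measure t \<omega>)"
    using int_abs meas by (rule Bochner_Integration.integrable_bound) auto
qed

end

section \<open>Approximation by step functions\<close>

lemma measurable_step [measurable]:
  fixes c :: "int \<Rightarrow> real"
  shows "(\<lambda>x::real. c \<lceil>x * real N / t\<rceil>) \<in> borel_measurable borel"
proof -
  have "(\<lambda>x::real. \<lceil>x * real N / t\<rceil>) \<in> borel \<rightarrow>\<^sub>M count_space UNIV" by measurable
  then show ?thesis by (rule measurable_compose) simp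
qed

text \<open>A step function on N equal cells is encoded as \<open>c\<close> applied to the cell
  index. Ceiling rather than floor makes the cells open on the left and closed on the right, as
  increments of \<open>S\<close> require; hence the cell counted as k from 0 has index k +
  1.\<close>

lemma ceiling_cell_iff:
  assumes "0 < t" "0 < N"
  shows "\<lceil>x * real N / t\<rceil> = int k + 1 \<longleftrightarrow> x \<in> {t * real k / real N<..t * real (Suc k) / real N}"
  using assms by (auto simp: ceiling_eq_iff field_simps)

lemma ceiling_cell_range:
  assumes "0 < t" "0 < N" "0 < x" "x \<le> t"
  obtains k where "k < N" "\<lceil>x * real N / t\<rceil> = int k + 1"
proof -
  define j where "j = \<lceil>x * real N / t\<rceil>"
  have "0 < x * real N / t" using assms by simp
  then have "0 < j" unfolding j_def by linarith
  moreover have "j \<le> int N"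
    using assms by (simp add: j_def ceiling_le_iff field_simps mult_right_mono)
  ultimately show thesis
    by (intro that[of "nat (j - 1)"]) (auto simp flip: j_def)
qed

lemma integral_step:
  fixes c :: "int \<Rightarrow> real"
  assumes t: "0 < t" and N: "0 < N" and \<nu>: "finite_measure \<nu>"
    and sets: "sets \<nu> = sets borel" and AE: "AE x in \<nu>. 0 < x \<and> x \<le> t"
  shows "integrable \<nu> (\<lambda>x. c \<lceil>x * real N / t\<rceil>)"
    and "(\<integral>x. c \<lceil>x * real N / t\<rceil> \<partial>\<nu>) =
      (\<Sum>k<N. c (int k + 1) * measure \<nu> {t * real k / real N<..t * real (Suc k) / real N})"
proof -
  note [measurable_cong] = sets
  interpret \<nu>: finite_measure \<nu> by (rule \<nu>)
  let ?A = "\<lambda>k. {t * real k / real N<..t * real (Suc k) / real N}"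
  let ?s = "\<lambda>x. \<Sum>k<N. c (int k + 1) * indicat_real (?A k) x"
  have ae: "AE x in \<nu>. ?s x = c \<lceil>x * real N / t\<rceil>"
    using AE
  proof eventually_elim
    case (elim x)
    then obtain k where k: "k < N" "\<lceil>x * real N / t\<rceil> = int k + 1"
      using ceiling_cell_range[OF t N] by metis
    have "indicat_real (?A j) x = (if j = k then 1 else 0)" for j
      unfolding indicator_def of_bool_def ceiling_cell_iff[OF t N, symmetric] using k by auto
    then have "?s x = (\<Sum>j<N. if j = k then c (int k + 1) else 0)"
      by (intro sum.cong) auto
    then show ?case using k by simp
  qed
  have int: "integrable \<nu> ?s"
    by (intro Bochner_Integration.integrable_sum integrable_mult_right)
      (auto simp: sets \<nu>.emeasure_eq_measure)
  show "integrable \<nu> (\<lambda>x. c \<lceil>x * real N / t\<rceil>)"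
    by (rule integrable_cong_AE_imp[OF int _ ae]) measurable
  have "(\<integral>x. c \<lceil>x * real N / t\<rceil> \<partial>\<nu>) = (\<integral>x. ?s x \<partial>\<nu>)"
    by (intro integral_cong_AE borel_measurable_integrable[OF int]) (measurable, use ae in auto)
  also have "\<dots> = (\<Sum>k<N. c (int k + 1) * measure \<nu> (?A k))"
    by (subst Bochner_Integration.integral_sum)
      (auto simp: sets \<nu>.emeasure_eq_measure)
  finally show "(\<integral>x. c \<lceil>x * real N / t\<rceil> \<partial>\<nu>) = (\<Sum>k<N. c (int k + 1) * measure \<nu> (?A k))" .
qed

text \<open>The ceiling of y / K depends on y only through its ceiling. Grids of N and K cells thus
  have the common refinement of N K cells, which makes sums of step functions step
  functions.\<close>

lemma step_refine:
  fixes c :: "int \<Rightarrow> real"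
  assumes "0 < K"
  shows "\<exists>c'. \<forall>x. c \<lceil>x * real N / t\<rceil> = c' \<lceil>x * real (N * K) / t\<rceil>"
proof (intro exI allI)
  fix x
  have "x * real N / t = (x * real (N * K) / t) / real_of_int (int K)"
    using assms by simp
  then have "\<lceil>x * real N / t\<rceil> = - ((- \<lceil>x * real (N * K) / t\<rceil>) div int K)"
    unfolding ceiling_def using floor_divide_real_eq_div[of "int K" "- (x * real (N * K) / t)"]
    by (simp del: of_nat_mult)
  then show "c \<lceil>x * real N / t\<rceil> = (\<lambda>j. c (- ((- j) div int K))) \<lceil>x * real (N * K) / t\<rceil>" by simp
qed

text \<open>Integrability is part of the notion because the Bochner integral of a non-integrable
  difference is 0 and would satisfy the second condition vacuously.\<close>

definition step_approximable :: "real \<Rightarrow> (real \<Rightarrow> real) \<Rightarrow> bool" where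
  "step_approximable t h \<longleftrightarrow> integrable (leb t) h \<and>
    (\<forall>e>0. \<exists>N>0. \<exists>c. (\<integral>x. \<bar>h x - c \<lceil>x * real N / t\<rceil>\<bar> \<partial>leb t) < e)"

context
  fixes t :: real
  assumes t: "0 < t"
begin

lemma integrable_leb_step: "0 < N \<Longrightarrow> integrable (leb t) (\<lambda>x. c \<lceil>x * real N / t\<rceil>)"
  for c :: "int \<Rightarrow> real"
  using t by (intro integral_step(1) finite_measure_leb AE_leb_Ioc) auto

lemma step_approximable_add:
  assumes "step_approximable t h" "step_approximable t k"
  shows "step_approximable t (\<lambda>x. h x + k x)"
  unfolding step_approximable_def
proof (intro conjI allI impI)
  have int: "integrable (leb t) h" "integrable (leb t) k"
    using assms by (auto simp: step_approximable_def)
  then show "integrable (leb t) (\<lambda>x. h x + k x)" by simp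
  fix e :: real assume "0 < e"
  then have "0 < e / 2" by simp
  with assms obtain N c K d where N: "0 < N" "(\<integral>x. \<bar>h x - c \<lceil>x * real N / t\<rceil>\<bar> \<partial>leb t) < e / 2"
    and K: "0 < K" "(\<integral>x. \<bar>k x - d \<lceil>x * real K / t\<rceil>\<bar> \<partial>leb t) < e / 2"
    unfolding step_approximable_def by meson
  obtain c' where c': "\<And>x. c \<lceil>x * real N / t\<rceil> = c' \<lceil>x * real (N * K) / t\<rceil>"
    using step_refine[OF K(1)] by blast
  obtain d' where d': "\<And>x. d \<lceil>x * real K / t\<rceil> = d' \<lceil>x * real (N * K) / t\<rceil>"
    using step_refine[OF N(1), of d K t] by (auto simp: mult.commute[of K])
  define b where "b j = c' j + d' j" for j
  have "(\<integral>x. \<bar>(h x + k x) - b \<lceil>x * real (N * K) / t\<rceil>\<bar> \<partial>leb t) \<le>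
      (\<integral>x. \<bar>h x - c \<lceil>x * real N / t\<rceil>\<bar> + \<bar>k x - d \<lceil>x * real K / t\<rceil>\<bar> \<partial>leb t)"
    using int N K unfolding c' d' b_def
    by (intro integral_mono integrable_abs Bochner_Integration.integrable_add
        Bochner_Integration.integrable_diff integrable_leb_step) auto
  also have "\<dots> = (\<integral>x. \<bar>h x - c \<lceil>x * real N / t\<rceil>\<bar> \<partial>leb t) + (\<integral>x. \<bar>k x - d \<lceil>x * real K / t\<rceil>\<bar> \<partial>leb t)"
    using int N K
    by (intro Bochner_Integration.integral_add integrable_abs
        Bochner_Integration.integrable_diff integrable_leb_step) auto
  also have "\<dots> < e" using N K by simp
  finally show "\<exists>N>0. \<exists>c. (\<integral>x. \<bar>(h x + k x) - c \<lceil>x * real N / t\<rceil>\<bar> \<partial>leb t) < e"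
    using N K by (intro exI[of _ "N * K"] conjI exI[of _ b]) auto
qed

lemma step_approximable_const: "step_approximable t (\<lambda>_. a)"
  unfolding step_approximable_def by (auto intro!: exI[of _ 1] exI[of _ "\<lambda>_. a"])

lemma step_approximable_cmult:
  assumes "step_approximable t h"
  shows "step_approximable t (\<lambda>x. a * h x)"
proof (cases "a = 0")
  case True
  then show ?thesis using step_approximable_const[of 0] by simp
next
  case False
  show ?thesis
    unfolding step_approximable_def
  proof (intro conjI allI impI)
    show "integrable (leb t) (\<lambda>x. a * h x)" using assms by (simp add: step_approximable_def)
    fix e :: real assume "0 < e"
    then have "0 < e / \<bar>a\<bar>" using False by simp
    then obtain N c where N: "0 < N" "(\<integral>x. \<bar>h x - c \<lceil>x * real N / t\<rceil>\<bar> \<partial>leb t) < e / \<bar>a\<bar>"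
      using assms unfolding step_approximable_def by meson
    have "(\<integral>x. \<bar>a * h x - a * c \<lceil>x * real N / t\<rceil>\<bar> \<partial>leb t) =
        \<bar>a\<bar> * (\<integral>x. \<bar>h x - c \<lceil>x * real N / t\<rceil>\<bar> \<partial>leb t)"
      by (subst Bochner_Integration.integral_mult_right_zero[symmetric])
        (simp only: right_diff_distrib[symmetric] abs_mult)
    also have "\<dots> < e" using N False by (simp add: pos_less_divide_eq mult.commute)
    finally show "\<exists>N>0. \<exists>c. (\<integral>x. \<bar>a * h x - c \<lceil>x * real N / t\<rceil>\<bar> \<partial>leb t) < e"
      using N by (intro exI[of _ N] conjI exI[of _ "\<lambda>j. a * c j"]) auto
  qed
qed

lemma step_approximable_lim:
  assumes h: "integrable (leb t) h" and k: "\<And>i::nat. step_approximable t (k i)"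
    and lim: "(\<lambda>i. \<integral>x. \<bar>h x - k i x\<bar> \<partial>leb t) \<longlonglongrightarrow> 0"
  shows "step_approximable t h"
  unfolding step_approximable_def
proof (intro conjI allI impI)
  fix e :: real assume "0 < e"
  then have e: "0 < e / 2" by simp
  have "\<forall>\<^sub>F i in sequentially. (\<integral>x. \<bar>h x - k i x\<bar> \<partial>leb t) < e / 2"
    using order_tendstoD(2)[OF lim e] .
  then obtain i where i: "(\<integral>x. \<bar>h x - k i x\<bar> \<partial>leb t) < e / 2"
    by (auto simp: eventually_sequentially)
  have int: "integrable (leb t) (k i)" using k by (auto simp: step_approximable_def)
  obtain N c where N: "0 < N" "(\<integral>x. \<bar>k i x - c \<lceil>x * real N / t\<rceil>\<bar> \<partial>leb t) < e / 2"
    using e k[of i] unfolding step_approximable_def by meson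
  have "(\<integral>x. \<bar>h x - c \<lceil>x * real N / t\<rceil>\<bar> \<partial>leb t) \<le>
      (\<integral>x. \<bar>h x - k i x\<bar> + \<bar>k i x - c \<lceil>x * real N / t\<rceil>\<bar> \<partial>leb t)"
    using int h N
    by (intro integral_mono integrable_abs Bochner_Integration.integrable_add
        Bochner_Integration.integrable_diff integrable_leb_step) auto
  also have "\<dots> = (\<integral>x. \<bar>h x - k i x\<bar> \<partial>leb t) + (\<integral>x. \<bar>k i x - c \<lceil>x * real N / t\<rceil>\<bar> \<partial>leb t)"
    using int h N
    by (intro Bochner_Integration.integral_add integrable_abs
        Bochner_Integration.integrable_diff integrable_leb_step) auto
  also have "\<dots> < e" using N i by simp
  finally show "\<exists>N>0. \<exists>c. (\<integral>x. \<bar>h x - c \<lceil>x * real N / t\<rceil>\<bar> \<partial>leb t) < e"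
    using N by blast
qed (rule h)

lemma step_approximable_sum:
  "(\<And>i. i \<in> I \<Longrightarrow> step_approximable t (k i)) \<Longrightarrow> step_approximable t (\<lambda>x. \<Sum>i\<in>I. k i x)"
proof (induction I rule: infinite_finite_induct)
  case (insert i I)
  then show ?case by (simp add: step_approximable_add)
qed (simp_all add: step_approximable_const)

lemma integrable_leb_indicator: "A \<in> sets borel \<Longrightarrow> integrable (leb t) (indicat_real A)"
  by (intro leb.integrable_const_bound[where B = 1]) (auto simp: indicator_def)

lemma step_approximable_indicator_atMost: "step_approximable t (indicat_real {..a})"
  unfolding step_approximable_def
proof (intro conjI allI impI)
  fix e :: real assume e: "0 < e"
  obtain N where N: "t / e < real N" using reals_Archimedean2 by blast
  have N0: "0 < N" using N t e by (metis divide_pos_pos less_trans of_nat_0_less_iff)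
  define c :: "int \<Rightarrow> real" where "c k = (if k \<le> \<lceil>a * real N / t\<rceil> then 1 else 0)" for k
  \<comment> \<open>The step function is 1 up to the end of the cell that contains a, so it differs
    from the indicator at most on one cell length to the right of a.\<close>
  have le: "\<bar>indicat_real {..a} x - c \<lceil>x * real N / t\<rceil>\<bar> \<le> indicat_real {a<..a + t / N} x" for x
  proof (cases "x \<le> a")
    case True
    then have "\<lceil>x * real N / t\<rceil> \<le> \<lceil>a * real N / t\<rceil>"
      using t by (intro ceiling_mono divide_right_mono mult_right_mono) auto
    then show ?thesis using True by (simp add: c_def)
  next
    case False
    show ?thesis
    proof (cases "\<lceil>x * real N / t\<rceil> \<le> \<lceil>a * real N / t\<rceil>")
      case True
      then have "x * real N / t \<le> of_int \<lceil>a * real N / t\<rceil>" by (simp add: ceiling_le_iff)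
      also have "\<dots> \<le> a * real N / t + 1" by simp
      finally have "x \<le> a + t / N" using t N0 by (simp add: field_simps)
      then show ?thesis using False by (simp add: c_def indicator_def)
    qed (use False in \<open>simp add: c_def indicator_def\<close>)
  qed
  have "(\<integral>x. \<bar>indicat_real {..a} x - c \<lceil>x * real N / t\<rceil>\<bar> \<partial>leb t) \<le> (\<integral>x. indicat_real {a<..a + t / N} x \<partial>leb t)"
    using N0 le
    by (intro integral_mono integrable_abs Bochner_Integration.integrable_diff integrable_leb_step
        integrable_leb_indicator) auto
  also have "\<dots> = measure (leb t) {a<..a + t / N}" by simp
  also have "\<dots> \<le> t / N"
  proof -
    have "emeasure (leb t) {a<..a + t / N} \<le> emeasure lborel {a<..a + t / N}"
      by (auto simp: emeasure_leb intro!: emeasure_mono)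
    then show ?thesis using t by (simp add: leb.emeasure_eq_measure)
  qed
  also have "t / N < e" using N N0 e by (simp add: field_simps)
  finally show "\<exists>N>0. \<exists>c. (\<integral>x. \<bar>indicat_real {..a} x - c \<lceil>x * real N / t\<rceil>\<bar> \<partial>leb t) < e"
    using N0 by blast
qed (simp add: integrable_leb_indicator)

text \<open>Again a Dynkin argument from the half-lines. For a disjoint union the partial sums are
  indicators of finite unions and converge in L^1 because \<open>leb t\<close> is finite.\<close>

lemma step_approximable_indicator:
  assumes "A \<in> sets borel"
  shows "step_approximable t (indicat_real A)"
proof -
  let ?G = "range (\<lambda>a::real. {..a})"
  have borel: "sets borel = sigma_sets UNIV ?G" by (simp add: borel_eq_atMost)
  have "Int_stable ?G" by (auto simp: Int_stable_def)
  moreover have "?G \<subseteq> Pow UNIV" by auto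
  moreover have "A \<in> sigma_sets UNIV ?G" using assms borel by simp
  ultimately show ?thesis
  proof (induction rule: sigma_sets_induct_disjoint)
    case (basic A)
    then show ?case using step_approximable_indicator_atMost by auto
  next
    case empty
    then show ?case using step_approximable_const[of 0] by (simp add: indicator_def)
  next
    case (compl A)
    have "indicat_real (UNIV - A) = (\<lambda>x. 1 + (- 1) * indicator A x)"
      by (auto simp: indicator_def)
    then show ?case
      using step_approximable_add[OF step_approximable_const[of 1] step_approximable_cmult[OF compl(2), of "- 1"]]
      by simp
  next
    case (union A)
    then have A: "A i \<in> sets borel" for i using borel by auto
    then have [measurable]: "(\<Union>i. A i) \<in> sets borel" by auto
    note A[measurable]
    let ?k = "\<lambda>n x. \<Sum>i<n. indicat_real (A i) x"
    have k: "?k n x = indicator (\<Union>i<n. A i) x" for n x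
      using union(1) by (intro indicator_UN_disjoint[symmetric])
        (auto simp: disjoint_family_on_def)
    show ?case
    proof (rule step_approximable_lim)
      show "integrable (leb t) (indicat_real (\<Union>i. A i))" by (intro integrable_leb_indicator) auto
      show "step_approximable t (?k n)" for n
        using union by (intro step_approximable_sum) auto
      have "(\<lambda>n. \<integral>x. \<bar>indicat_real (\<Union>i. A i) x - ?k n x\<bar> \<partial>leb t) \<longlonglongrightarrow> (\<integral>x. 0 \<partial>leb t)"
      proof (rule integral_dominated_convergence[where w = "\<lambda>_. 1"])
        show "AE x in leb t. (\<lambda>n. \<bar>indicat_real (\<Union>i. A i) x - ?k n x\<bar>) \<longlonglongrightarrow> 0"
        proof (rule AE_I2)
          fix x
          have "(\<lambda>n. \<bar>indicat_real (\<Union>i. A i) x - indicator (\<Union>i<n. A i) x\<bar>) \<longlonglongrightarrow>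
              \<bar>indicat_real (\<Union>i. A i) x - indicator (\<Union>i. A i) x\<bar>"
            by (intro tendsto_intros LIMSEQ_indicator_UN)
          then show "(\<lambda>n. \<bar>indicat_real (\<Union>i. A i) x - ?k n x\<bar>) \<longlonglongrightarrow> 0"
            unfolding k by simp
        qed
        show "AE x in leb t. norm \<bar>indicat_real (\<Union>i. A i) x - ?k n x\<bar> \<le> 1" for n
          unfolding k by (auto simp: indicator_def)
      qed auto
      then show "(\<lambda>n. \<integral>x. \<bar>indicat_real (\<Union>i. A i) x - ?k n x\<bar> \<partial>leb t) \<longlonglongrightarrow> 0" by simp
    qed
  qed
qed

lemma step_approximable_integrable:
  assumes "integrable (leb t) h"
  shows "step_approximable t h"
  using assms
proof (induction rule: integrable_induct)
  case (base A c)
  then show ?case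
    using step_approximable_cmult[OF step_approximable_indicator, of A c] by (simp add: mult.commute)
next
  case (add f g)
  then show ?case by (intro step_approximable_add)
next
  case (lim f s)
  note [measurable] = lim.hyps(1,4)
  show ?case
  proof (rule step_approximable_lim[of _ s])
    have "(\<lambda>i. \<integral>x. \<bar>f x - s i x\<bar> \<partial>leb t) \<longlonglongrightarrow> (\<integral>x. 0 \<partial>leb t)"
    proof (rule integral_dominated_convergence[where w = "\<lambda>x. 3 * \<bar>f x\<bar>"])
      show "AE x in leb t. (\<lambda>i. \<bar>f x - s i x\<bar>) \<longlonglongrightarrow> 0"
      proof (rule AE_I2)
        fix x
        have "(\<lambda>i. \<bar>f x - s i x\<bar>) \<longlonglongrightarrow> \<bar>f x - f x\<bar>"
          using lim.hyps(2)[of x] by (intro tendsto_intros) auto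
        then show "(\<lambda>i. \<bar>f x - s i x\<bar>) \<longlonglongrightarrow> 0" by simp
      qed
      \<comment> \<open>The approximants of the induction rule satisfy \<bar>s i x\<bar> \<le> 2
        \<bar>f x\<bar>, whence the factor 3.\<close>
      show "AE x in leb t. norm \<bar>f x - s i x\<bar> \<le> 3 * \<bar>f x\<bar>" for i
      proof (rule AE_I2)
        fix x
        show "norm \<bar>f x - s i x\<bar> \<le> 3 * \<bar>f x\<bar>"
          using lim.hyps(3)[of x i] by simp
      qed
    qed (use lim in auto)
    then show "(\<lambda>i. \<integral>x. \<bar>f x - s i x\<bar> \<partial>leb t) \<longlonglongrightarrow> 0" by simp
  qed (use lim in auto)
qed

lemma step_approximation:
  fixes h :: "real \<Rightarrow> real"
  assumes [measurable]: "h \<in> borel_measurable borel" and h: "\<And>x. a \<le> h x" "\<And>x. h x \<le> b"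
    and e: "0 < e"
  shows "\<exists>N>0. \<exists>c. (\<forall>j. a \<le> c j \<and> c j \<le> b) \<and> (\<integral>x. \<bar>h x - c \<lceil>x * real N / t\<rceil>\<bar> \<partial>leb t) < e"
proof -
  have "norm (h x) \<le> \<bar>a\<bar> + \<bar>b\<bar>" for x
    using h[of x] by (simp add: abs_if)
  then have int: "integrable (leb t) h"
    by (intro leb.integrable_const_bound[where B = "\<bar>a\<bar> + \<bar>b\<bar>"]) auto
  obtain N c where N: "0 < N" "(\<integral>x. \<bar>h x - c \<lceil>x * real N / t\<rceil>\<bar> \<partial>leb t) < e"
    using step_approximable_integrable[OF int] e unfolding step_approximable_def by meson
  \<comment> \<open>Clipping to [a, b], where \<open>h\<close> takes its values, cannot increase the
    distance to \<open>h\<close>. The bounds keep 1 - d away from 0 when b < 1.\<close>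
  define d where "d j = max a (min b (c j))" for j
  have "a \<le> b" using h[of 0] by simp
  have "(\<integral>x. \<bar>h x - d \<lceil>x * real N / t\<rceil>\<bar> \<partial>leb t) \<le> (\<integral>x. \<bar>h x - c \<lceil>x * real N / t\<rceil>\<bar> \<partial>leb t)"
  proof (intro integral_mono integrable_abs Bochner_Integration.integrable_diff
      integrable_leb_step int N)
    show "\<bar>h x - d \<lceil>x * real N / t\<rceil>\<bar> \<le> \<bar>h x - c \<lceil>x * real N / t\<rceil>\<bar>" for x
      using h[of x] by (auto simp: d_def)
  qed
  then show ?thesis
    using N \<open>a \<le> b\<close> by (intro exI[of _ N] conjI exI[of _ d]) (auto simp: d_def)
qed

end

section \<open>Exponential moments of integrals\<close>

lemma ln_lipschitz:
  fixes x y :: real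
  assumes "0 < d" "d \<le> x" "d \<le> y"
  shows "\<bar>ln x - ln y\<bar> \<le> \<bar>x - y\<bar> / d"
proof -
  have *: "ln u - ln v \<le> \<bar>u - v\<bar> / d" if "d \<le> u" "d \<le> v" for u v :: real
  proof -
    have "ln u - ln v \<le> (u - v) / v" using assms that by (intro ln_diff_le) auto
    also have "\<dots> \<le> \<bar>u - v\<bar> / d" using assms that by (intro frac_le) auto
    finally show ?thesis .
  qed
  show ?thesis using *[of x y] *[of y x] assms by (auto simp: abs_minus_commute)
qed

context standard_gamma_process
begin

lemma mgf_increment:
  assumes "0 \<le> r" "0 \<le> s" "c < 1"
  shows "integrable M (\<lambda>\<omega>. exp (c * (S (r + s) \<omega> - S r \<omega>)))"
    and "expectation (\<lambda>\<omega>. exp (c * (S (r + s) \<omega> - S r \<omega>))) = (1 - c) powr (- s)"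
proof -
  have [measurable]: "S u \<in> borel_measurable M" if "u \<ge> 0" for u
    using random_variable_S[OF that] .
  have [measurable]: "S (r + s) \<in> borel_measurable M" "S r \<in> borel_measurable M" "S s \<in> borel_measurable M"
    using assms by auto
  have eq: "distr M borel (\<lambda>\<omega>. S (r + s) \<omega> - S r \<omega>) = distr M borel (S s)"
    using assms by (intro stationary_increments)
  have "integrable (distr M borel (S s)) (\<lambda>y. exp (c * y))"
    using mgf(1)[of s c] assms by (subst integrable_distr_eq) auto
  then show "integrable M (\<lambda>\<omega>. exp (c * (S (r + s) \<omega> - S r \<omega>)))"
    unfolding eq[symmetric] by (subst (asm) integrable_distr_eq) auto
  have "expectation (\<lambda>\<omega>. exp (c * (S (r + s) \<omega> - S r \<omega>))) =
      (\<integral>y. exp (c * y) \<partial>distr M borel (\<lambda>\<omega>. S (r + s) \<omega> - S r \<omega>))"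
    by (subst integral_distr) auto
  also have "\<dots> = expectation (\<lambda>\<omega>. exp (c * S s \<omega>))"
    unfolding eq by (subst integral_distr) auto
  finally show "expectation (\<lambda>\<omega>. exp (c * (S (r + s) \<omega> - S r \<omega>))) = (1 - c) powr (- s)"
    using mgf(2)[of s c] assms by simp
qed

text \<open>The integral is a linear combination of increments over disjoint cells, so its
  exponential is a product of independent factors. Each has expectation exp (- (t/N) ln (1 - c)),
  and the exponents add up to a Lebesgue integral.\<close>

lemma exp_integral_step:
  fixes c :: "int \<Rightarrow> real"
  assumes t: "0 < t" and N: "0 < N" and c: "\<And>j. c j < 1"
  defines "X \<equiv> \<lambda>\<omega>. \<integral>x. c \<lceil>x * real N / t\<rceil> \<partial>jump_measure t \<omega>"
  shows "integrable M (\<lambda>\<omega>. exp (X \<omega>))"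
    and "expectation (\<lambda>\<omega>. exp (X \<omega>)) = exp (- (\<integral>x. ln (1 - c \<lceil>x * real N / t\<rceil>) \<partial>leb t))"
proof -
  define s where "s k = t * real k / real N" for k
  have s: "0 \<le> s k" "s k \<le> s (Suc k)" "s (Suc k) = s k + t / real N" for k
    using t N by (auto simp: s_def field_simps)
  have sN: "s (Suc k) \<le> t" if "k < N" for k
  proof -
    have "real (Suc k) \<le> real N" using that by simp
    then show ?thesis using t N by (simp add: s_def field_simps del: of_nat_Suc)
  qed
  define Y where "Y k \<omega> = exp (c (int k + 1) * (S (s (Suc k)) \<omega> - S (s k) \<omega>))" for k \<omega>
  have X: "exp (X \<omega>) = (\<Prod>k<N. Y k \<omega>)" if \<omega>: "\<omega> \<in> space M" for \<omega>
  proof -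
    have "X \<omega> = (\<Sum>k<N. c (int k + 1) * measure (jump_measure t \<omega>) {s k<..s (Suc k)})"
      unfolding X_def s_def using t N \<omega>
      by (intro integral_step finite_measure_jump_measure AE_jump_measure_Ioc) auto
    also have "\<dots> = (\<Sum>k<N. c (int k + 1) * (S (s (Suc k)) \<omega> - S (s k) \<omega>))"
      using s sN \<omega> S_mono[OF \<omega> s(1) s(2)]
      by (intro sum.cong) (auto simp: measure_def emeasure_jump_measure_Ioc)
    finally show ?thesis by (simp add: exp_sum Y_def)
  qed
  have indep: "indep_vars (\<lambda>_. borel) Y {..<N}"
    unfolding Y_def using indep_increments[of s N] s
    by (intro indep_vars_compose2[where Y = "\<lambda>k y. exp (c (int k + 1) * y)"]) auto
  have int: "integrable M (Y k)" for k
    unfolding Y_def s(3) using t c s by (intro mgf_increment) auto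
  have E: "expectation (Y k) = (1 - c (int k + 1)) powr (- (t / real N))" for k
    unfolding Y_def s(3) using t c s by (intro mgf_increment) auto
  have "integrable M (\<lambda>\<omega>. \<Prod>k<N. Y k \<omega>)"
    using int by (intro indep_vars_integrable indep) auto
  then show "integrable M (\<lambda>\<omega>. exp (X \<omega>))"
    by (subst Bochner_Integration.integrable_cong[OF refl X])
  have "expectation (\<lambda>\<omega>. exp (X \<omega>)) = expectation (\<lambda>\<omega>. \<Prod>k<N. Y k \<omega>)"
    using X by (intro Bochner_Integration.integral_cong) auto
  also have "\<dots> = (\<Prod>k<N. expectation (Y k))"
    using int by (intro indep_vars_lebesgue_integral indep) auto
  also have "\<dots> = (\<Prod>k<N. exp (- (t / real N) * ln (1 - c (int k + 1))))"
    unfolding E powr_def using c by (intro prod.cong) (auto simp: less_le)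
  also have "\<dots> = exp (- (\<Sum>k<N. ln (1 - c (int k + 1)) * (t / real N)))"
    by (simp add: exp_sum[symmetric] sum_negf mult.commute)
  also have "(\<Sum>k<N. ln (1 - c (int k + 1)) * (t / real N)) =
      (\<Sum>k<N. ln (1 - c (int k + 1)) * measure (leb t) {s k<..s (Suc k)})"
  proof (intro sum.cong refl)
    fix k assume k: "k \<in> {..<N}"
    have "emeasure (leb t) {s k<..s (Suc k)} = emeasure lborel {s k<..s (Suc k)}"
      using sN[of k] s[of k] k by (auto simp: emeasure_leb intro!: arg_cong[where f = "emeasure lborel"])
    then have "measure (leb t) {s k<..s (Suc k)} = t / real N"
      using s(2,3)[of k] t by (simp add: measure_def)
    then show "ln (1 - c (int k + 1)) * (t / real N) =
        ln (1 - c (int k + 1)) * measure (leb t) {s k<..s (Suc k)}" by simp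
  qed
  \<comment> \<open>ln (1 - c) of the cell index is itself a step function on the same grid, so
    \<open>integral_step\<close> is read backwards, now for \<open>leb t\<close>.\<close>
  also have "\<dots> = (\<integral>x. ln (1 - c \<lceil>x * real N / t\<rceil>) \<partial>leb t)"
    unfolding s_def using t N
    by (intro integral_step(2)[of t N "leb t" "\<lambda>j. ln (1 - c j)", symmetric] finite_measure_leb AE_leb_Ioc) auto
  finally show "expectation (\<lambda>\<omega>. exp (X \<omega>)) = exp (- (\<integral>x. ln (1 - c \<lceil>x * real N / t\<rceil>) \<partial>leb t))" .
qed

text \<open>The approximants stay in [a, b], on which ln (1 - x) is Lipschitz with constant 1 / (1 -
  b); this gives convergence of the expectations, while the mean measure gives L^1 convergence of
  the integrals. The sign statement for b \<le> 0 supplies a dominating constant for negative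
  exponents.\<close>

lemma exp_integral_approximation:
  fixes h :: "real \<Rightarrow> real"
  assumes t: "0 < t" and [measurable]: "h \<in> borel_measurable borel"
    and h: "\<And>x. a \<le> h x" "\<And>x. h x \<le> b" and b: "b < 1"
  obtains Y :: "nat \<Rightarrow> 'a \<Rightarrow> real" where
    "\<And>n. integrable M (\<lambda>\<omega>. exp (Y n \<omega>))"
    "\<And>n \<omega>. b \<le> 0 \<Longrightarrow> Y n \<omega> \<le> 0"
    "AE \<omega> in M. (\<lambda>n. Y n \<omega>) \<longlonglongrightarrow> (\<integral>x. h x \<partial>jump_measure t \<omega>)"
    "(\<lambda>n. expectation (\<lambda>\<omega>. exp (Y n \<omega>))) \<longlonglongrightarrow> exp (- (\<integral>x. ln (1 - h x) \<partial>leb t))"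
proof -
  have "\<exists>N c. 0 < N \<and> (\<forall>j. a \<le> c j \<and> c j \<le> b) \<and>
      (\<integral>x. \<bar>h x - c \<lceil>x * real N / t\<rceil>\<bar> \<partial>leb t) < inverse (real (Suc n))" for n
    using step_approximation[OF t assms(2) h, of "inverse (real (Suc n))"] by (auto simp del: of_nat_Suc)
  then obtain N c where N: "\<And>n. 0 < N n" and c: "\<And>n j. a \<le> c n j" "\<And>n j. c n j \<le> b"
    and L1: "\<And>n. (\<integral>x. \<bar>h x - c n \<lceil>x * real (N n) / t\<rceil>\<bar> \<partial>leb t) < inverse (real (Suc n))"
    by metis
  define s where "s n x = c n \<lceil>x * real (N n) / t\<rceil>" for n x
  have s[measurable]: "s n \<in> borel_measurable borel" for n unfolding s_def by measurable
  have sab: "a \<le> s n x" "s n x \<le> b" for n x using c by (auto simp: s_def)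
  have bd: "\<bar>h x\<bar> \<le> \<bar>a\<bar> + \<bar>b\<bar>" "\<bar>s n x\<bar> \<le> \<bar>a\<bar> + \<bar>b\<bar>" for n x
    using h[of x] sab[of n x] by (auto simp: abs_if)
  have bd': "\<bar>h x - s n x\<bar> \<le> 2 * (\<bar>a\<bar> + \<bar>b\<bar>)" for n x
    using bd(1)[of x] bd(2)[of n x] abs_triangle_ineq4[of "h x" "s n x"] by argo
  have conv: "(\<lambda>n. \<integral>x. \<bar>h x - s n x\<bar> \<partial>leb t) \<longlonglongrightarrow> 0"
  proof (rule tendsto_sandwich[OF _ _ tendsto_const LIMSEQ_inverse_real_of_nat])
    show "\<forall>\<^sub>F n in sequentially. (\<integral>x. \<bar>h x - s n x\<bar> \<partial>leb t) \<le> inverse (real (Suc n))"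
      using L1 by (auto simp: s_def intro!: always_eventually less_imp_le)
  qed (auto intro!: always_eventually integral_nonneg_AE)
  let ?X = "\<lambda>\<omega>. \<integral>x. h x \<partial>jump_measure t \<omega>"
  let ?Y = "\<lambda>n \<omega>. \<integral>x. s n x \<partial>jump_measure t \<omega>"
  have diff: "?X \<omega> - ?Y n \<omega> = (\<integral>x. h x - s n x \<partial>jump_measure t \<omega>)" if "\<omega> \<in> space M" for n \<omega>
  proof -
    interpret J: finite_measure "jump_measure t \<omega>"
      using that t by (intro finite_measure_jump_measure) auto
    show ?thesis
      using bd by (intro Bochner_Integration.integral_diff[symmetric] J.integrable_const_bound) auto
  qed
  have int_d: "integrable M (\<lambda>\<omega>. ?X \<omega> - ?Y n \<omega>)" for n
    using integral_jump_measure(4)[of t "\<lambda>x. h x - s n x", OF _ _ bd'] t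
    by (subst Bochner_Integration.integrable_cong[OF refl diff]) auto
  have "(\<lambda>n. expectation (\<lambda>\<omega>. norm (?X \<omega> - ?Y n \<omega>))) \<longlonglongrightarrow> 0"
  proof (rule tendsto_sandwich[OF _ _ tendsto_const conv])
    show "\<forall>\<^sub>F n in sequentially. expectation (\<lambda>\<omega>. norm (?X \<omega> - ?Y n \<omega>)) \<le> (\<integral>x. \<bar>h x - s n x\<bar> \<partial>leb t)"
    proof (rule always_eventually, rule allI)
      fix n
      note I = integral_jump_measure[of t "\<lambda>x. h x - s n x", OF _ _ bd']
      have "expectation (\<lambda>\<omega>. norm (?X \<omega> - ?Y n \<omega>)) \<le>
          expectation (\<lambda>\<omega>. \<integral>x. \<bar>h x - s n x\<bar> \<partial>jump_measure t \<omega>)"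
      proof (rule integral_mono)
        show "norm (?X \<omega> - ?Y n \<omega>) \<le> (\<integral>x. \<bar>h x - s n x\<bar> \<partial>jump_measure t \<omega>)"
          if "\<omega> \<in> space M" for \<omega>
          unfolding diff[OF that] using integral_norm_bound[of "jump_measure t \<omega>" "\<lambda>x. h x - s n x"]
          by simp
      qed (use int_d I t in auto)
      also have "\<dots> = (\<integral>x. \<bar>h x - s n x\<bar> \<partial>leb t)" using I t by simp
      finally show "expectation (\<lambda>\<omega>. norm (?X \<omega> - ?Y n \<omega>)) \<le> (\<integral>x. \<bar>h x - s n x\<bar> \<partial>leb t)" .
    qed
  qed (auto intro!: always_eventually)
  \<comment> \<open>Convergence in mean gives almost sure convergence only along a subsequence; the
    limit of the expectations is unaffected by passing to it.\<close>
  from tendsto_L1_AE_subseq[OF int_d this] obtain r where r: "strict_mono r"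
    and AE: "AE \<omega> in M. (\<lambda>n. ?X \<omega> - ?Y (r n) \<omega>) \<longlonglongrightarrow> 0" by auto
  have ln_conv: "(\<lambda>n. \<integral>x. ln (1 - s n x) \<partial>leb t) \<longlonglongrightarrow> (\<integral>x. ln (1 - h x) \<partial>leb t)"
  proof (rule Lim_null[THEN iffD2], rule tendsto_0_le[OF conv, where K = "1 / (1 - b)"],
      rule always_eventually, rule allI)
    fix n
    have ln_bd: "\<bar>ln (1 - x)\<bar> \<le> \<bar>ln (1 - a)\<bar> + \<bar>ln (1 - b)\<bar>" if "a \<le> x" "x \<le> b" for x
    proof -
      have "ln (1 - b) \<le> ln (1 - x)" "ln (1 - x) \<le> ln (1 - a)"
        using that b by auto
      then show ?thesis by linarith
    qed
    have int1: "integrable (leb t) (\<lambda>x. ln (1 - s n x))"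
      using ln_bd[OF sab] by (intro leb.integrable_const_bound) auto
    have int2: "integrable (leb t) (\<lambda>x. ln (1 - h x))"
      using ln_bd[OF h] by (intro leb.integrable_const_bound) auto
    have int3: "integrable (leb t) (\<lambda>x. h x - s n x)"
      using bd' by (intro leb.integrable_const_bound) auto
    have "norm ((\<integral>x. ln (1 - s n x) \<partial>leb t) - (\<integral>x. ln (1 - h x) \<partial>leb t)) =
        norm (\<integral>x. ln (1 - s n x) - ln (1 - h x) \<partial>leb t)"
      using int1 int2 by simp
    also have "\<dots> \<le> (\<integral>x. \<bar>ln (1 - s n x) - ln (1 - h x)\<bar> \<partial>leb t)"
      using integral_norm_bound[of "leb t" "\<lambda>x. ln (1 - s n x) - ln (1 - h x)"] by simp
    also have "\<dots> \<le> (\<integral>x. \<bar>h x - s n x\<bar> * (1 / (1 - b)) \<partial>leb t)"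
    proof (rule integral_mono)
      show "\<bar>ln (1 - s n x) - ln (1 - h x)\<bar> \<le> \<bar>h x - s n x\<bar> * (1 / (1 - b))" for x
        using ln_lipschitz[of "1 - b" "1 - s n x" "1 - h x"] sab[of n x] h[of x] b by simp
    qed (use int1 int2 int3 in auto)
    also have "\<dots> = (\<integral>x. \<bar>h x - s n x\<bar> \<partial>leb t) * (1 / (1 - b))" by simp
    finally show "norm ((\<integral>x. ln (1 - s n x) \<partial>leb t) - (\<integral>x. ln (1 - h x) \<partial>leb t)) \<le>
        norm (\<integral>x. \<bar>h x - s n x\<bar> \<partial>leb t) * (1 / (1 - b))" by simp
  qed
  have cl: "c n j < 1" for n j using c(2)[of n j] b by simp
  have E: "integrable M (\<lambda>\<omega>. exp (?Y n \<omega>))"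
    "expectation (\<lambda>\<omega>. exp (?Y n \<omega>)) = exp (- (\<integral>x. ln (1 - s n x) \<partial>leb t))" for n
    unfolding s_def by (intro exp_integral_step t N cl)+
  show thesis
  proof (rule that[of "\<lambda>n. ?Y (r n)"])
    show "integrable M (\<lambda>\<omega>. exp (?Y (r n) \<omega>))" for n by (rule E)
    show "?Y (r n) \<omega> \<le> 0" if "b \<le> 0" for n \<omega>
    proof -
      have "0 \<le> (\<integral>x. - s (r n) x \<partial>jump_measure t \<omega>)"
        using sab(2)[of "r n"] that by (intro integral_nonneg_AE AE_I2) (metis neg_0_le_iff_le order_trans)
      then show ?thesis by simp
    qed
    show "AE \<omega> in M. (\<lambda>n. ?Y (r n) \<omega>) \<longlonglongrightarrow> ?X \<omega>"
      using AE
    proof eventually_elim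
      case (elim \<omega>)
      have "(\<lambda>n. ?X \<omega> - (?X \<omega> - ?Y (r n) \<omega>)) \<longlonglongrightarrow> ?X \<omega> - 0"
        using elim by (intro tendsto_intros)
      then show ?case by simp
    qed
    have "(\<lambda>n. exp (- (\<integral>x. ln (1 - s (r n) x) \<partial>leb t))) \<longlonglongrightarrow> exp (- (\<integral>x. ln (1 - h x) \<partial>leb t))"
      using LIMSEQ_subseq_LIMSEQ[OF ln_conv r] by (intro tendsto_intros) (simp add: comp_def)
    then show "(\<lambda>n. expectation (\<lambda>\<omega>. exp (?Y (r n) \<omega>))) \<longlonglongrightarrow> exp (- (\<integral>x. ln (1 - h x) \<partial>leb t))"
      unfolding E(2) .
  qed
qed

text \<open>Fatou's lemma along the approximation. The one-sided bound suffices for upper estimates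
  of exponential moments and spares an argument for uniform integrability.\<close>

lemma exp_integral_bound:
  fixes h :: "real \<Rightarrow> real"
  assumes t: "0 < t" and [measurable]: "h \<in> borel_measurable borel"
    and h: "\<And>x. a \<le> h x" "\<And>x. h x \<le> b" and b: "b < 1"
  shows "integrable M (\<lambda>\<omega>. exp (\<integral>x. h x \<partial>jump_measure t \<omega>))"
    and "expectation (\<lambda>\<omega>. exp (\<integral>x. h x \<partial>jump_measure t \<omega>)) \<le> exp (- (\<integral>x. ln (1 - h x) \<partial>leb t))"
proof -
  obtain Y where int: "\<And>n. integrable M (\<lambda>\<omega>. exp (Y n \<omega>))"
    and AE: "AE \<omega> in M. (\<lambda>n. Y n \<omega>) \<longlonglongrightarrow> (\<integral>x. h x \<partial>jump_measure t \<omega>)"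
    and lim: "(\<lambda>n. expectation (\<lambda>\<omega>. exp (Y n \<omega>))) \<longlonglongrightarrow> exp (- (\<integral>x. ln (1 - h x) \<partial>leb t))"
    by (rule exp_integral_approximation[OF t assms(2) h b]) blast
  have bd: "\<bar>h x\<bar> \<le> \<bar>a\<bar> + \<bar>b\<bar>" for x using h[of x] by (auto simp: abs_if)
  have [measurable]: "(\<lambda>\<omega>. \<integral>x. h x \<partial>jump_measure t \<omega>) \<in> borel_measurable M"
    using t bd by (intro integral_jump_measure) auto
  have [measurable]: "(\<lambda>\<omega>. exp (Y n \<omega>)) \<in> borel_measurable M" for n using int by auto
  have "(\<integral>\<^sup>+\<omega>. ennreal (exp (\<integral>x. h x \<partial>jump_measure t \<omega>)) \<partial>M) =
      (\<integral>\<^sup>+\<omega>. liminf (\<lambda>n. ennreal (exp (Y n \<omega>))) \<partial>M)"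
  proof (rule nn_integral_cong_AE)
    show "AE \<omega> in M. ennreal (exp (\<integral>x. h x \<partial>jump_measure t \<omega>)) = liminf (\<lambda>n. ennreal (exp (Y n \<omega>)))"
      using AE by eventually_elim (auto intro!: lim_imp_Liminf[symmetric] tendsto_intros)
  qed
  also have "\<dots> \<le> liminf (\<lambda>n. \<integral>\<^sup>+\<omega>. ennreal (exp (Y n \<omega>)) \<partial>M)"
    by (rule nn_integral_liminf) measurable
  also have "\<dots> = liminf (\<lambda>n. ennreal (expectation (\<lambda>\<omega>. exp (Y n \<omega>))))"
    using int by (simp add: nn_integral_eq_integral)
  also have "\<dots> = ennreal (exp (- (\<integral>x. ln (1 - h x) \<partial>leb t)))"
    using lim by (intro lim_imp_Liminf tendsto_intros) auto
  finally have le: "(\<integral>\<^sup>+\<omega>. ennreal (exp (\<integral>x. h x \<partial>jump_measure t \<omega>)) \<partial>M) \<le>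
      ennreal (exp (- (\<integral>x. ln (1 - h x) \<partial>leb t)))" .
  show int: "integrable M (\<lambda>\<omega>. exp (\<integral>x. h x \<partial>jump_measure t \<omega>))"
    using le by (intro integrableI_nonneg) (auto simp: le_less_trans)
  show "expectation (\<lambda>\<omega>. exp (\<integral>x. h x \<partial>jump_measure t \<omega>)) \<le> exp (- (\<integral>x. ln (1 - h x) \<partial>leb t))"
    using le int by (subst (asm) nn_integral_eq_integral) auto
qed

text \<open>For nonpositive exponents the exponentials are dominated by 1, so the limit holds with
  equality. The direction that Fatou does not give is the one needed to bound the integral of ln (1
  + h) from below.\<close>

lemma laplace_integral:
  fixes h :: "real \<Rightarrow> real"
  assumes t: "0 < t" and [measurable]: "h \<in> borel_measurable borel"
    and h: "\<And>x. 0 \<le> h x" "\<And>x. h x \<le> b"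
  shows "expectation (\<lambda>\<omega>. exp (- (\<integral>x. h x \<partial>jump_measure t \<omega>))) = exp (- (\<integral>x. ln (1 + h x) \<partial>leb t))"
proof -
  obtain Y where int: "\<And>n. integrable M (\<lambda>\<omega>. exp (Y n \<omega>))"
    and Y: "\<And>n \<omega>. Y n \<omega> \<le> 0"
    and AE: "AE \<omega> in M. (\<lambda>n. Y n \<omega>) \<longlonglongrightarrow> (\<integral>x. - h x \<partial>jump_measure t \<omega>)"
    and lim: "(\<lambda>n. expectation (\<lambda>\<omega>. exp (Y n \<omega>))) \<longlonglongrightarrow> exp (- (\<integral>x. ln (1 - - h x) \<partial>leb t))"
  proof (rule exp_integral_approximation[OF t, of "\<lambda>x. - h x" "- b" 0])
  qed (use h in auto)
  have bd: "\<bar>- h x\<bar> \<le> b" for x using h[of x] by auto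
  have [measurable]: "(\<lambda>\<omega>. \<integral>x. - h x \<partial>jump_measure t \<omega>) \<in> borel_measurable M"
    using t bd by (intro integral_jump_measure) auto
  have "(\<lambda>n. expectation (\<lambda>\<omega>. exp (Y n \<omega>))) \<longlonglongrightarrow> expectation (\<lambda>\<omega>. exp (\<integral>x. - h x \<partial>jump_measure t \<omega>))"
  proof (rule integral_dominated_convergence[where w = "\<lambda>_. 1"])
    show "AE \<omega> in M. (\<lambda>n. exp (Y n \<omega>)) \<longlonglongrightarrow> exp (\<integral>x. - h x \<partial>jump_measure t \<omega>)"
      using AE by eventually_elim (intro tendsto_intros)
    show "(\<lambda>\<omega>. exp (\<integral>x. - h x \<partial>jump_measure t \<omega>)) \<in> borel_measurable M" by measurable
  qed (use Y int in auto)
  from LIMSEQ_unique[OF this lim] show ?thesis by simp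
qed

end

section \<open>Increasing integrands\<close>

lemma integral_leb_restrict:
  fixes h :: "real \<Rightarrow> real"
  assumes [measurable]: "h \<in> borel_measurable borel" and "a \<le> b"
  shows "(\<integral>x. h x \<partial>leb a) = (\<integral>x. indicator {..a} x * h x \<partial>leb b)"
  using assms
  by (auto simp: integral_leb set_lebesgue_integral_def indicator_def
      intro!: Bochner_Integration.integral_cong)

lemma measure_leb_greaterThan: "0 \<le> a \<Longrightarrow> a \<le> b \<Longrightarrow> measure (leb b) {a<..} = b - a"
proof -
  assume "0 \<le> a" "a \<le> b"
  then have "{a<..} \<inter> {0<..b} = {a<..b}" by auto
  then show ?thesis using \<open>a \<le> b\<close> by (simp add: measure_def emeasure_leb)
qed

context
  fixes F :: "real \<Rightarrow> real"
  assumes F_mono: "mono F" and F_nonneg: "\<And>x. 0 \<le> F x"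
begin

lemma integrable_leb_dominated:
  assumes [measurable]: "k \<in> borel_measurable borel" and k: "\<And>x. \<bar>k x\<bar> \<le> F x"
  shows "integrable (leb t) k"
proof (rule leb.integrable_const_bound)
  note [measurable] = borel_measurable_mono[OF F_mono]
  show "AE x in leb t. norm (k x) \<le> F t"
    using AE_leb_Ioc
  proof eventually_elim
    case (elim x)
    then show ?case using k[of x] monoD[OF F_mono, of x t] by simp
  qed
qed simp

lemma integral_leb_diff:
  assumes [measurable]: "k \<in> borel_measurable borel" and k: "\<And>x. \<bar>k x\<bar> \<le> F x" and "a \<le> b"
  shows "(\<integral>x. k x \<partial>leb b) - (\<integral>x. k x \<partial>leb a) = (\<integral>x. indicator {a<..} x * k x \<partial>leb b)"
proof -
  note [measurable] = borel_measurable_mono[OF F_mono]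
  have int: "integrable (leb b) (\<lambda>x. indicator A x * k x)" if "A \<in> sets borel" for A
    using that k F_nonneg by (intro integrable_leb_dominated) (auto simp: indicator_def)
  have "(\<integral>x. k x \<partial>leb b) - (\<integral>x. k x \<partial>leb a) =
      (\<integral>x. k x - indicator {..a} x * k x \<partial>leb b)"
    using int[of UNIV] int[of "{..a}"] assms by (simp add: integral_leb_restrict)
  also have "\<dots> = (\<integral>x. indicator {a<..} x * k x \<partial>leb b)"
    by (intro Bochner_Integration.integral_cong) (auto simp: indicator_def)
  finally show ?thesis .
qed

lemma integral_leb_F_diff_le:
  assumes "0 \<le> a" "a \<le> b"
  shows "(\<integral>x. F x \<partial>leb b) - (\<integral>x. F x \<partial>leb a) \<le> F b * (b - a)"
proof -
  note [measurable] = borel_measurable_mono[OF F_mono]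
  have int: "integrable (leb b) (\<lambda>x. indicator {a<..} x * F x)"
    using F_nonneg by (intro integrable_leb_dominated) (auto simp: indicator_def)
  have "(\<integral>x. F x \<partial>leb b) - (\<integral>x. F x \<partial>leb a) = (\<integral>x. indicator {a<..} x * F x \<partial>leb b)"
    using assms F_nonneg by (intro integral_leb_diff) auto
  also have "\<dots> \<le> (\<integral>x. indicator {a<..} x * F b \<partial>leb b)"
  proof (rule integral_mono_AE[OF int])
    show "AE x in leb b. indicator {a<..} x * F x \<le> indicator {a<..} x * F b"
      using AE_leb_Ioc by eventually_elim (auto simp: indicator_def intro: monoD[OF F_mono])
    show "integrable (leb b) (\<lambda>x. indicator {a<..} x * F b)"
      by (intro leb.integrable_const_bound[where B = "F b"]) (auto simp: indicator_def F_nonneg)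
  qed
  also have "\<dots> = F b * (b - a)" using assms by (simp add: measure_leb_greaterThan)
  finally show ?thesis .
qed

lemma integral_leb_F_mono:
  assumes "a \<le> b"
  shows "(\<integral>x. F x \<partial>leb a) \<le> (\<integral>x. F x \<partial>leb b)"
proof -
  note [measurable] = borel_measurable_mono[OF F_mono]
  have "0 \<le> (\<integral>x. indicator {a<..} x * F x \<partial>leb b)"
    using F_nonneg by (intro integral_nonneg_AE) auto
  also have "\<dots> = (\<integral>x. F x \<partial>leb b) - (\<integral>x. F x \<partial>leb a)"
    using assms F_nonneg by (intro integral_leb_diff[symmetric]) auto
  finally show ?thesis by simp
qed

text \<open>As a function of its end point the integral is Lipschitz on [a, b] with constant
  \<open>F b\<close>, hence continuous. It provides a time at which the integral has exactly
  doubled.\<close>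

lemma integral_leb_F_ivt:
  assumes "0 \<le> a" "a \<le> b" "(\<integral>x. F x \<partial>leb a) \<le> y" "y \<le> (\<integral>x. F x \<partial>leb b)"
  shows "\<exists>u. a \<le> u \<and> u \<le> b \<and> (\<integral>x. F x \<partial>leb u) = y"
proof (rule IVT'[OF assms(3,4,2)])
  note [measurable] = borel_measurable_mono[OF F_mono]
  have lip: "\<bar>(\<integral>x. F x \<partial>leb v) - (\<integral>x. F x \<partial>leb u)\<bar> \<le> F b * (v - u)"
    if "a \<le> u" "u \<le> v" "v \<le> b" for u v
  proof -
    have "\<bar>(\<integral>x. F x \<partial>leb v) - (\<integral>x. F x \<partial>leb u)\<bar> \<le> F v * (v - u)"
      using integral_leb_F_diff_le[of u v] integral_leb_F_mono[of u v] that assms by auto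
    also have "\<dots> \<le> F b * (v - u)"
      using that by (intro mult_right_mono monoD[OF F_mono]) auto
    finally show ?thesis .
  qed
  have "(F b)-lipschitz_on {a..b} (\<lambda>u. \<integral>x. F x \<partial>leb u)"
  proof (rule lipschitz_onI)
    fix u v assume "u \<in> {a..b}" "v \<in> {a..b}"
    then show "dist (\<integral>x. F x \<partial>leb u) (\<integral>x. F x \<partial>leb v) \<le> F b * dist u v"
      using lip[of u v] lip[of v u] by (cases u v rule: linorder_cases) (auto simp: dist_real_def abs_minus_commute)
  qed (rule F_nonneg)
  then show "continuous_on {a..b} (\<lambda>u. \<integral>x. F x \<partial>leb u)"
    by (rule lipschitz_on_continuous_on)
qed

text \<open>
  Each window of length \<open>T\<close> carries the same mass of \<open>g\<close>, and on it \<open>F\<close> dominates its values on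
  the preceding window.
\<close>

lemma integral_leb_periodic_lower_bound:
  assumes [measurable]: "g \<in> borel_measurable borel"
    and g: "\<And>x. 0 \<le> g x" "\<And>x. g x \<le> 1" and T: "0 < T" and per: "\<And>x. 0 \<le> x \<Longrightarrow> g (x + T) = g x"
  shows "(\<integral>x. g x \<partial>leb T) / T * (\<integral>x. F x \<partial>leb (real n * T)) \<le> (\<integral>x. F x * g x \<partial>leb (real (Suc n) * T))"
proof (induction n)
  case 0
  note [measurable] = borel_measurable_mono[OF F_mono]
  have "(\<integral>x. F x \<partial>leb 0) = 0" by (simp add: integral_leb set_lebesgue_integral_def)
  moreover have "0 \<le> (\<integral>x. F x * g x \<partial>leb (real (Suc 0) * T))"
    using F_nonneg g by (intro integral_nonneg_AE) auto
  ultimately show ?case by simp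
next
  case (Suc n)
  note [measurable] = borel_measurable_mono[OF F_mono]
  define d where "d = (\<integral>x. g x \<partial>leb T)"
  define a where "a = real (Suc n) * T"
  have a: "real n * T = a - T" "real (Suc (Suc n)) * T = a + T" "0 \<le> a" "0 \<le> a - T"
    using T by (auto simp: a_def algebra_simps)
  have d: "0 \<le> d" unfolding d_def using g by (intro integral_nonneg_AE) auto
  have per': "g (x + real j * T) = g x" if "0 \<le> x" for x j
    using that
  proof (induction j)
    case (Suc j)
    have "g (x + real (Suc j) * T) = g ((x + real j * T) + T)" by (simp add: algebra_simps)
    also have "\<dots> = g (x + real j * T)" using Suc T by (intro per) simp
    finally show ?case using Suc by simp
  qed simp
  \<comment> \<open>Translation by a, a multiple of the period, maps (0, T] onto (a, a + T].\<close>
  have win: "(\<integral>x. indicator {a<..} x * g x \<partial>leb (a + T)) = d"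
  proof -
    have "(\<integral>x. indicator {a<..} x * g x \<partial>leb (a + T)) =
        (\<integral>x. indicator {0<..a + T} x * (indicator {a<..} x * g x) \<partial>lborel)"
      by (simp add: integral_leb set_lebesgue_integral_def)
    also have "\<dots> = (\<integral>x. indicator {0<..a + T} (a + x) * (indicator {a<..} (a + x) * g (a + x)) \<partial>lborel)"
      by (subst lborel_integral_real_affine[of 1 _ a]) auto
    also have "\<dots> = (\<integral>x. indicator {0<..T} x * g x \<partial>lborel)"
    proof (intro Bochner_Integration.integral_cong refl)
      fix x
      show "indicator {0<..a + T} (a + x) * (indicator {a<..} (a + x) * g (a + x)) =
          indicator {0<..T} x * g x"
        using per'[of x "Suc n"] a(3) by (auto simp: indicator_def a_def add.commute)
    qed
    finally show ?thesis by (simp add: d_def integral_leb set_lebesgue_integral_def)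
  qed
  have Fg: "\<bar>F x * g x\<bar> \<le> F x" for x using F_nonneg[of x] g[of x] by (simp add: abs_mult mult_left_le)
  have gint: "integrable (leb t) (\<lambda>x. indicator A x * g x)" if "A \<in> sets borel" for t A
    using that g by (intro leb.integrable_const_bound[where B = 1]) (auto simp: indicator_def)
  have "F a * d = (\<integral>x. F a * (indicator {a<..} x * g x) \<partial>leb (a + T))" using win by simp
  also have "\<dots> \<le> (\<integral>x. indicator {a<..} x * (F x * g x) \<partial>leb (a + T))"
  proof (rule integral_mono)
    show "integrable (leb (a + T)) (\<lambda>x. F a * (indicator {a<..} x * g x))"
      using gint by (intro integrable_mult_right) auto
    show "integrable (leb (a + T)) (\<lambda>x. indicator {a<..} x * (F x * g x))"
      using F_nonneg Fg by (intro integrable_leb_dominated) (auto simp: indicator_def)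
    show "F a * (indicator {a<..} x * g x) \<le> indicator {a<..} x * (F x * g x)" for x
      using g[of x] monoD[OF F_mono, of a x] by (auto simp: indicator_def intro: mult_right_mono)
  qed
  also have "\<dots> = (\<integral>x. F x * g x \<partial>leb (a + T)) - (\<integral>x. F x * g x \<partial>leb a)"
    using T Fg by (intro integral_leb_diff[symmetric]) auto
  finally have 1: "F a * d \<le> (\<integral>x. F x * g x \<partial>leb (a + T)) - (\<integral>x. F x * g x \<partial>leb a)" .
  \<comment> \<open>\<open>F a\<close> is the pivot: it bounds \<open>F\<close> from below on the
    window that starts at a, used just before, and from above on the window that ends at a, used
    here.\<close>
  have "(\<integral>x. F x \<partial>leb a) - (\<integral>x. F x \<partial>leb (a - T)) \<le> F a * T"
    using integral_leb_F_diff_le[OF a(4), of a] T by simp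
  then have "d / T * ((\<integral>x. F x \<partial>leb a) - (\<integral>x. F x \<partial>leb (a - T))) \<le> d / T * (F a * T)"
    using d T by (intro mult_left_mono) simp_all
  then have 2: "d / T * (\<integral>x. F x \<partial>leb a) \<le> d / T * (\<integral>x. F x \<partial>leb (a - T)) + F a * d"
    using T by (simp add: algebra_simps)
  have "d / T * (\<integral>x. F x \<partial>leb (a - T)) \<le> (\<integral>x. F x * g x \<partial>leb a)"
    using Suc by (simp only: a(1) d_def[symmetric] a_def[symmetric])
  with 1 2 have "d / T * (\<integral>x. F x \<partial>leb a) \<le> (\<integral>x. F x * g x \<partial>leb (a + T))" by argo
  then show ?case by (simp only: a(2) d_def[symmetric] a_def[symmetric])
qed

text \<open>The bound at multiples of T lags one window behind, and t need not be a multiple.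
  Together this leaves a final stretch of length at most 2 T, whose share of the integral of
  \<open>F\<close> vanishes in the limit.\<close>

lemma integral_leb_periodic_eventually:
  assumes [measurable]: "g \<in> borel_measurable borel"
    and g: "\<And>x. 0 \<le> g x" "\<And>x. g x \<le> 1" and T: "0 < T" and per: "\<And>x. 0 \<le> x \<Longrightarrow> g (x + T) = g x"
    and pos: "0 < (\<integral>x. g x \<partial>leb T)"
    and lim: "((\<lambda>t. F t / (\<integral>x. F x \<partial>leb t)) \<longlongrightarrow> 0) at_top"
    and div: "filterlim (\<lambda>t. \<integral>x. F x \<partial>leb t) at_top at_top"
  obtains c where "0 < c" "\<forall>\<^sub>F t in at_top. c * (\<integral>x. F x \<partial>leb t) \<le> (\<integral>x. F x * g x \<partial>leb t)"
proof (rule that)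
  note [measurable] = borel_measurable_mono[OF F_mono]
  let ?d = "\<integral>x. g x \<partial>leb T"
  \<comment> \<open>The mean of \<open>g\<close> over a period, halved. The threshold 1 / (4 T)
    below makes the final stretch, of mass at most 2 T F t, no more than half of the
    integral.\<close>
  show "0 < ?d / T / 2" using pos T by simp
  have "\<forall>\<^sub>F t in at_top. F t / (\<integral>x. F x \<partial>leb t) < 1 / (4 * T)"
    using order_tendstoD(2)[OF lim] T by simp
  moreover have "\<forall>\<^sub>F t in at_top. 0 < (\<integral>x. F x \<partial>leb t)"
    using div by (simp add: filterlim_at_top_dense)
  moreover have "\<forall>\<^sub>F t in at_top. 2 * T \<le> t" by (rule eventually_ge_at_top)
  ultimately show "\<forall>\<^sub>F t in at_top. ?d / T / 2 * (\<integral>x. F x \<partial>leb t) \<le> (\<integral>x. F x * g x \<partial>leb t)"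
  proof eventually_elim
    case (elim t)
    \<comment> \<open>The largest n with (n + 1) T \<le> t; as t \<ge> 2 T, the subtraction of
      natural numbers does not truncate.\<close>
    define n where "n = nat \<lfloor>t / T\<rfloor> - 1"
    have n: "real (Suc n) * T \<le> t" "t - 2 * T \<le> real n * T"
    proof -
      have fl: "2 \<le> \<lfloor>t / T\<rfloor>" using elim T by (simp add: le_floor_iff pos_le_divide_eq)
      then have n: "real n = of_int \<lfloor>t / T\<rfloor> - 1" unfolding n_def by linarith
      have "of_int \<lfloor>t / T\<rfloor> \<le> t / T" "t / T < of_int \<lfloor>t / T\<rfloor> + 1" by linarith+
      then have "real n + 1 \<le> t / T" "t / T \<le> real n + 2" using n by linarith+
      then show "real (Suc n) * T \<le> t" "t - 2 * T \<le> real n * T"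
        using T by (auto simp: field_simps)
    qed
    have Fg: "\<bar>F x * g x\<bar> \<le> F x" for x using F_nonneg[of x] g[of x] by (simp add: abs_mult mult_left_le)
    have "(\<integral>x. F x \<partial>leb t) - (\<integral>x. F x \<partial>leb (real n * T)) \<le> F t * (t - real n * T)"
    proof (rule integral_leb_F_diff_le)
      show "real n * T \<le> t" using n T by (simp add: algebra_simps)
    qed (use T in simp)
    also have "\<dots> \<le> F t * (2 * T)" using n F_nonneg by (intro mult_left_mono) auto
    also have "\<dots> \<le> (\<integral>x. F x \<partial>leb t) / 2"
      using elim T by (simp add: field_simps)
    finally have "(\<integral>x. F x \<partial>leb t) / 2 \<le> (\<integral>x. F x \<partial>leb (real n * T))" by simp
    then have "?d / T * ((\<integral>x. F x \<partial>leb t) / 2) \<le> ?d / T * (\<integral>x. F x \<partial>leb (real n * T))"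
      using pos T by (intro mult_left_mono) auto
    also have "\<dots> \<le> (\<integral>x. F x * g x \<partial>leb (real (Suc n) * T))"
      using g T per by (intro integral_leb_periodic_lower_bound) auto
    also have "\<dots> \<le> (\<integral>x. F x * g x \<partial>leb t)"
    proof -
      have "0 \<le> (\<integral>x. indicator {real (Suc n) * T<..} x * (F x * g x) \<partial>leb t)"
        using F_nonneg g by (intro integral_nonneg_AE) auto
      then show ?thesis using integral_leb_diff[of "\<lambda>x. F x * g x", OF _ Fg n(1)] by simp
    qed
    finally show ?case by simp
  qed
qed

end

section \<open>Smallness of an increasing integrand relative to its integral\<close>

text \<open>Off the exceptional event Y \<ge> c - \<epsilon>, and on it exp (- Y) \<le> 1. Closeness
  in probability thereby bounds the Laplace transform.\<close>

lemma (in prob_space) expectation_exp_neg_le: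
  assumes [measurable]: "Y \<in> borel_measurable M" and Y: "\<And>\<omega>. \<omega> \<in> space M \<Longrightarrow> 0 \<le> Y \<omega>"
  shows "expectation (\<lambda>\<omega>. exp (- Y \<omega>)) \<le> exp (\<epsilon> - c) + prob {\<omega> \<in> space M. \<bar>Y \<omega> - c\<bar> > \<epsilon>}"
proof -
  let ?A = "{\<omega> \<in> space M. \<bar>Y \<omega> - c\<bar> > \<epsilon>}"
  have "expectation (\<lambda>\<omega>. exp (- Y \<omega>)) \<le> expectation (\<lambda>\<omega>. exp (\<epsilon> - c) + indicator ?A \<omega>)"
  proof (rule integral_mono)
    show "integrable M (\<lambda>\<omega>. exp (- Y \<omega>))"
      using Y by (intro integrable_const_bound[where B = 1]) auto
    show "integrable M (\<lambda>\<omega>. exp (\<epsilon> - c) + indicator ?A \<omega>)"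
      by (intro Bochner_Integration.integrable_add) (auto simp: less_top[symmetric])
    fix \<omega> assume \<omega>: "\<omega> \<in> space M"
    show "exp (- Y \<omega>) \<le> exp (\<epsilon> - c) + indicator ?A \<omega>"
    proof (cases "\<omega> \<in> ?A")
      case True
      have "exp (- Y \<omega>) \<le> 1" using Y[OF \<omega>] by simp
      then show ?thesis using True by (simp add: add_increasing)
    next
      case False
      then show ?thesis using \<omega> by (auto simp: abs_if split: if_splits)
    qed
  qed
  also have "\<dots> = exp (\<epsilon> - c) + prob ?A"
    by (subst Bochner_Integration.integral_add) (auto simp: prob_space less_top[symmetric])
  finally show ?thesis .
qed

text \<open>By concavity ln (1 + y) / y decreases in y > 0: beyond a the graph lies below its
  tangent at a, whose slope 1 / (1 + a) is at most that of the chord from 0 to a.\<close>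

lemma ln_add_one_le_slope:
  fixes a y :: real
  assumes a: "0 < a" and y: "a \<le> y"
  shows "ln (1 + y) \<le> ln (1 + a) / a * y"
proof -
  have "ln (1 + y) - ln (1 + a) \<le> (1 + y - (1 + a)) / (1 + a)"
    using assms by (intro ln_diff_le) auto
  moreover have "a / (1 + a) \<le> ln (1 + a)"
    using ln_diff_le[of 1 "1 + a"] a by (simp add: field_simps)
  then have "1 / (1 + a) \<le> ln (1 + a) / a" using a by (simp add: field_simps)
  then have "(y - a) * (1 / (1 + a)) \<le> (y - a) * (ln (1 + a) / a)"
    using y by (intro mult_left_mono) auto
  ultimately have "ln (1 + y) \<le> ln (1 + a) + (y - a) * (ln (1 + a) / a)" by simp
  also have "\<dots> = ln (1 + a) / a * y" using a by (simp add: field_simps)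
  finally show ?thesis .
qed

context standard_gamma_process
begin

text \<open>
  The Laplace transforms of the normalised integrals converge to that of the constant 1. If \<open>F t\<close>
  were comparable with its integral \<open>\<Lambda> t\<close>, then at the time \<open>u\<close> at which \<open>\<Lambda> u = 2 \<Lambda> t\<close> half of the
  mass of \<open>F / \<Lambda> u\<close> would sit where this function is bounded below, and there \<open>ln (1 + y)\<close>
  is smaller than \<open>y\<close> by a fixed factor.
\<close>

lemma orderly_divergence_imp_ratio_tendsto_0:
  assumes F_mono: "mono F" and F_nonneg: "\<And>x. 0 \<le> F x"
    and div: "filterlim (\<lambda>t. \<integral>x. F x \<partial>leb t) at_top at_top"
    and conv: "tends_in_probability M
      (\<lambda>t \<omega>. (\<integral>x. F x \<partial>jump_measure t \<omega>) / (\<integral>x. F x \<partial>leb t)) 1 at_top"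
  shows "((\<lambda>t. F t / (\<integral>x. F x \<partial>leb t)) \<longlongrightarrow> 0) at_top"
proof (rule tendstoI)
  fix \<delta> :: real assume \<delta>: "0 < \<delta>"
  note [measurable] = borel_measurable_mono[OF F_mono]
  let ?L = "\<lambda>t. \<integral>x. F x \<partial>leb t"
  let ?X = "\<lambda>t \<omega>. (\<integral>x. F x \<partial>jump_measure t \<omega>) / ?L t"
  \<comment> \<open>If F t \<ge> \<delta> \<open>?L t\<close> and \<open>?L u\<close> = 2
    \<open>?L t\<close>, then F / \<open>?L u\<close> is at least \<delta> / 2 after t. There ln (1
    + y) \<le> \<kappa> y; the two halves of the mass contribute at most 1/2 and \<kappa>/2, in
    total 1 - \<eta>.\<close>
  define a where "a = \<delta> / 2"
  define \<kappa> where "\<kappa> = ln (1 + a) / a"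
  define \<eta> where "\<eta> = (1 - \<kappa>) / 2"
  have a: "0 < a" using \<delta> by (simp add: a_def)
  have \<kappa>: "0 \<le> \<kappa>" "\<kappa> < 1"
    using a ln_add_one_self_le_self2[of a] ln_eq_minus_one[of "1 + a"] ln_le_minus_one[of "1 + a"]
    by (auto simp: \<kappa>_def less_le)
  then have \<eta>: "0 < \<eta>" by (simp add: \<eta>_def)
  \<comment> \<open>Half of \<eta> is spent on the deviation of the integral from 1, and this gap on
    the probability of a larger deviation; so the integral of ln (1 + p) exceeds 1 - \<eta>.\<close>
  have gap: "0 < exp (\<eta> - 1) - exp (\<eta> / 2 - 1)" using \<eta> by simp
  have "\<forall>\<^sub>F u in at_top. prob {\<omega> \<in> space M. \<bar>?X u \<omega> - 1\<bar> > \<eta> / 2} < exp (\<eta> - 1) - exp (\<eta> / 2 - 1)"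
    using conv \<eta> gap unfolding tends_in_probability_def
    by (intro order_tendstoD(2)[where y = 0]) (meson half_gt_zero)+
  then obtain u0 where u0: "\<And>u. u0 \<le> u \<Longrightarrow>
      prob {\<omega> \<in> space M. \<bar>?X u \<omega> - 1\<bar> > \<eta> / 2} < exp (\<eta> - 1) - exp (\<eta> / 2 - 1)"
    by (auto simp: eventually_at_top_linorder)
  \<comment> \<open>Freezing \<open>F\<close> after u makes the function bounded on the whole line,
    as \<open>laplace_integral\<close> demands, without changing it on (0, u].\<close>
  define p where "p u x = F (min x u) / ?L u" for u x
  have p[measurable]: "p u \<in> borel_measurable borel" for u unfolding p_def by measurable
  have p_bd: "0 \<le> p u x" "p u x \<le> F u / ?L u" if "0 < ?L u" for u x
    using that F_nonneg monoD[OF F_mono, of "min x u" u] by (auto simp: p_def divide_right_mono)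
  have p_eq: "p u x = F x / ?L u" if "x \<le> u" for u x using that by (simp add: p_def min_def)
  have ln_lower: "1 - \<eta> < (\<integral>x. ln (1 + p u x) \<partial>leb u)" if u: "u0 \<le> u" "0 < u" "0 < ?L u" for u
  proof -
    have meas: "(\<lambda>\<omega>. \<integral>x. F x \<partial>jump_measure u \<omega>) \<in> borel_measurable M"
      using F_nonneg u by (intro measurable_integral_jump_measure) auto
    have X: "?X u \<omega> = (\<integral>x. p u x \<partial>jump_measure u \<omega>)" for \<omega>
    proof -
      have "(\<integral>x. p u x \<partial>jump_measure u \<omega>) = (\<integral>x. F x / ?L u \<partial>jump_measure u \<omega>)"
      proof (rule integral_cong_AE)
        show "AE x in jump_measure u \<omega>. p u x = F x / ?L u"
          using AE_jump_measure_Ioc by eventually_elim (simp add: p_eq)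
      qed measurable
      then show ?thesis by simp
    qed
    have "exp (- (\<integral>x. ln (1 + p u x) \<partial>leb u)) = expectation (\<lambda>\<omega>. exp (- ?X u \<omega>))"
      unfolding X using p_bd[OF u(3)] u by (intro laplace_integral[symmetric]) auto
    also have "\<dots> \<le> exp (\<eta> / 2 - 1) + prob {\<omega> \<in> space M. \<bar>?X u \<omega> - 1\<bar> > \<eta> / 2}"
      using meas F_nonneg u
      by (intro expectation_exp_neg_le) (auto intro!: divide_nonneg_nonneg integral_nonneg_AE)
    also have "\<dots> < exp (\<eta> - 1)" using u0[OF u(1)] by simp
    finally show ?thesis by simp
  qed
  have "\<forall>\<^sub>F t in at_top. 0 < ?L t" using div by (simp add: filterlim_at_top_dense)
  moreover have "\<forall>\<^sub>F t in at_top. max u0 1 \<le> t" by (rule eventually_ge_at_top)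
  ultimately show "\<forall>\<^sub>F t in at_top. dist (F t / ?L t) 0 < \<delta>"
  proof eventually_elim
    case (elim t)
    have "F t / ?L t < \<delta>"
    proof (rule ccontr)
      assume "\<not> F t / ?L t < \<delta>"
      then have Ft: "\<delta> * ?L t \<le> F t" using elim by (simp add: field_simps)
      have "\<forall>\<^sub>F w in at_top. 2 * ?L t \<le> ?L w" using div by (simp add: filterlim_at_top)
      then have "\<forall>\<^sub>F w in at_top. 2 * ?L t \<le> ?L w \<and> t \<le> w"
        using eventually_ge_at_top by (rule eventually_conj)
      then obtain w where w: "2 * ?L t \<le> ?L w" "t \<le> w" by (auto simp: eventually_at_top_linorder)
      obtain u where u: "t \<le> u" "?L u = 2 * ?L t"
        using integral_leb_F_ivt[OF F_mono F_nonneg, of t w "2 * ?L t"] w elim by auto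
      have Lu: "0 < ?L u" using u elim by simp
      have int_F: "integrable (leb u) (\<lambda>x. indicator A x * F x)" if "A \<in> sets borel" for A
        using that F_nonneg
        by (intro integrable_leb_dominated[OF F_mono F_nonneg]) (auto simp: indicator_def)
      have "(\<integral>x. ln (1 + p u x) \<partial>leb u) \<le>
          (\<integral>x. (1 / ?L u) * (indicator {..t} x * F x) + (\<kappa> / ?L u) * (indicator {t<..} x * F x) \<partial>leb u)"
      proof (rule integral_mono_AE)
        show "integrable (leb u) (\<lambda>x. ln (1 + p u x))"
        proof (rule leb.integrable_const_bound)
          show "AE x in leb u. norm (ln (1 + p u x)) \<le> F u / ?L u"
          proof (rule AE_I2)
            fix x
            show "norm (ln (1 + p u x)) \<le> F u / ?L u"
              using p_bd[OF Lu, of x] ln_add_one_self_le_self[of "p u x"] by simp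
          qed
        qed measurable
        show "integrable (leb u)
            (\<lambda>x. (1 / ?L u) * (indicator {..t} x * F x) + (\<kappa> / ?L u) * (indicator {t<..} x * F x))"
          using int_F by (intro Bochner_Integration.integrable_add integrable_mult_right) auto
        show "AE x in leb u. ln (1 + p u x) \<le>
            (1 / ?L u) * (indicator {..t} x * F x) + (\<kappa> / ?L u) * (indicator {t<..} x * F x)"
          using AE_leb_Ioc
        proof eventually_elim
          case (elim x)
          show ?case
          proof (cases "x \<le> t")
            case True
            then show ?thesis
              using elim p_eq[of x u] p_bd[OF Lu, of x] ln_add_one_self_le_self[of "p u x"] by simp
          next
            case False
            have "a \<le> F t / ?L u" using Ft Lu u by (simp add: a_def field_simps)
            also have "\<dots> \<le> p u x"
              using elim False Lu monoD[OF F_mono, of t x] by (simp add: p_eq divide_right_mono)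
            finally have "ln (1 + p u x) \<le> \<kappa> * p u x"
              unfolding \<kappa>_def using a by (intro ln_add_one_le_slope) auto
            then show ?thesis using False elim p_eq[of x u] by simp
          qed
        qed
      qed
      also have "\<dots> = (1 / ?L u) * ?L t + (\<kappa> / ?L u) * (?L u - ?L t)"
        using int_F u integral_leb_diff[OF F_mono F_nonneg, of F t u] F_nonneg
        by (simp add: integral_leb_restrict[of F t u])
      also have "\<dots> = 1 - \<eta>" using u elim by (simp add: \<eta>_def field_simps)
      finally show False using ln_lower[of u] u elim Lu by simp
    qed
    then show ?case using elim F_nonneg[of t] by simp
  qed
qed

end

section \<open>Convergence\<close>

lemma powr_le_exp:
  fixes p y :: real
  assumes "0 < p" "0 \<le> y"
  shows "y powr p \<le> p powr p * exp y"
proof (cases "y = 0")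
  case False
  have "ln (y / p) \<le> y / p - 1" using assms False by (intro ln_le_minus_one) auto
  then have "p * ln (y / p) \<le> y - p" using assms by (simp add: field_simps)
  then have "p * ln y \<le> p * ln p + y"
    using assms False by (simp add: ln_div right_diff_distrib)
  then have "exp (p * ln y) \<le> exp (p * ln p) * exp y" by (simp flip: exp_add)
  then show ?thesis using assms False by (simp add: powr_def)
qed simp

text \<open>The right-hand bracket equals exp \<bar>x\<bar> (1 - exp (- \<bar>x\<bar>))^2. It is
  quadratic at 0, so for p < 2 it cannot dominate the power there; the additive e absorbs the range
  \<bar>x\<bar> \<le> e^(1/p), beyond which the squared factor is bounded away from 0.\<close>

lemma abs_powr_le_cosh:
  fixes p e :: real
  assumes p: "0 < p" and e: "0 < e"
  obtains C where "0 \<le> C" "\<And>x. \<bar>x\<bar> powr p \<le> e + C * (exp x + exp (- x) - 2)"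
proof (rule that)
  define r where "r = e powr (1 / p)"
  define C where "C = p powr p / (1 - exp (- r))\<^sup>2"
  have r: "0 < r" "r powr p = e" using p e by (auto simp: r_def powr_powr)
  show C: "0 \<le> C" by (simp add: C_def)
  fix x :: real
  have sq: "exp x + exp (- x) - 2 = exp \<bar>x\<bar> * (1 - exp (- \<bar>x\<bar>))\<^sup>2"
    by (cases "0 \<le> x") (auto simp: power2_eq_square algebra_simps simp flip: exp_add)
  show "\<bar>x\<bar> powr p \<le> e + C * (exp x + exp (- x) - 2)"
  proof (cases "\<bar>x\<bar> \<le> r")
    case True
    have "\<bar>x\<bar> powr p \<le> r powr p" using True p by (intro powr_mono2) auto
    then show ?thesis using C r by (simp add: sq add_increasing2)
  next
    case False
    have "\<bar>x\<bar> powr p \<le> p powr p * exp \<bar>x\<bar>" using p by (intro powr_le_exp) auto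
    also have "\<dots> = C * (exp \<bar>x\<bar> * (1 - exp (- r))\<^sup>2)"
      using r by (simp add: C_def)
    also have "\<dots> \<le> C * (exp \<bar>x\<bar> * (1 - exp (- \<bar>x\<bar>))\<^sup>2)"
      using False r C by (intro mult_left_mono power_mono) auto
    finally show ?thesis using e by (simp add: sq)
  qed
qed

lemma (in prob_space) tends_in_Lp_imp_in_probability:
  assumes "tends_in_Lp 1 M X c F"
  shows "tends_in_probability M X c F"
  unfolding tends_in_probability_def
proof (intro allI impI)
  fix \<epsilon> :: real assume \<epsilon>: "0 < \<epsilon>"
  have ev: "\<forall>\<^sub>F t in F. X t \<in> borel_measurable M \<and> integrable M (\<lambda>\<omega>. \<bar>X t \<omega> - c\<bar> powr 1)"
    and lim: "((\<lambda>t. \<integral>\<omega>. \<bar>X t \<omega> - c\<bar> powr 1 \<partial>M) \<longlongrightarrow> 0) F"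
    using assms by (auto simp: tends_in_Lp_def)
  have lim': "((\<lambda>t. (\<integral>\<omega>. \<bar>X t \<omega> - c\<bar> powr 1 \<partial>M) / \<epsilon>) \<longlongrightarrow> 0) F"
    using tendsto_divide[OF lim tendsto_const, of \<epsilon>] \<epsilon> by simp
  show "((\<lambda>t. prob {\<omega> \<in> space M. \<bar>X t \<omega> - c\<bar> > \<epsilon>}) \<longlongrightarrow> 0) F"
  proof (rule tendsto_sandwich[OF _ _ tendsto_const lim'])
    show "\<forall>\<^sub>F t in F. prob {\<omega> \<in> space M. \<bar>X t \<omega> - c\<bar> > \<epsilon>} \<le> (\<integral>\<omega>. \<bar>X t \<omega> - c\<bar> powr 1 \<partial>M) / \<epsilon>"
      using ev
    proof eventually_elim
      case (elim t)
      then have [measurable]: "X t \<in> borel_measurable M" by simp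
      have "prob {\<omega> \<in> space M. \<bar>X t \<omega> - c\<bar> > \<epsilon>} \<le> prob {\<omega> \<in> space M. \<bar>X t \<omega> - c\<bar> powr 1 \<ge> \<epsilon>}"
        by (intro finite_measure_mono) auto
      also have "\<dots> \<le> (\<integral>\<omega>. \<bar>X t \<omega> - c\<bar> powr 1 \<partial>M) / \<epsilon>"
        using elim \<epsilon> by (intro integral_Markov_inequality_measure[where A = "{}"]) auto
      finally show ?case .
    qed
  qed simp
qed

text \<open>The constant C depends on e but not on t, so e + C (2 exp (m t) - 2) tends to e, and e
  is arbitrary.\<close>

lemma (in prob_space) tends_in_Lp_of_exp_bounds:
  assumes p: "0 < p" and m: "(m \<longlongrightarrow> 0) F"
    and ev: "\<forall>\<^sub>F t in F. X t \<in> borel_measurable M \<and>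
      integrable M (\<lambda>\<omega>. exp (X t \<omega> - c)) \<and> expectation (\<lambda>\<omega>. exp (X t \<omega> - c)) \<le> exp (m t) \<and>
      integrable M (\<lambda>\<omega>. exp (c - X t \<omega>)) \<and> expectation (\<lambda>\<omega>. exp (c - X t \<omega>)) \<le> exp (m t)"
  shows "tends_in_Lp p M X c F"
proof -
  have bound: "integrable M (\<lambda>\<omega>. \<bar>X t \<omega> - c\<bar> powr p) \<and>
      expectation (\<lambda>\<omega>. \<bar>X t \<omega> - c\<bar> powr p) \<le> e + C * (2 * exp (m t) - 2)"
    if X: "X t \<in> borel_measurable M \<and>
        integrable M (\<lambda>\<omega>. exp (X t \<omega> - c)) \<and> expectation (\<lambda>\<omega>. exp (X t \<omega> - c)) \<le> exp (m t) \<and>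
        integrable M (\<lambda>\<omega>. exp (c - X t \<omega>)) \<and> expectation (\<lambda>\<omega>. exp (c - X t \<omega>)) \<le> exp (m t)"
      and C: "0 \<le> C" "\<And>x. \<bar>x\<bar> powr p \<le> e + C * (exp x + exp (- x) - 2)" for t C e
  proof -
    have [measurable]: "X t \<in> borel_measurable M" using X by simp
    let ?B = "\<lambda>\<omega>. e + C * (exp (X t \<omega> - c) + exp (c - X t \<omega>) - 2)"
    have le: "\<bar>X t \<omega> - c\<bar> powr p \<le> ?B \<omega>" for \<omega> using C(2)[of "X t \<omega> - c"] by simp
    have intB: "integrable M ?B" using X by auto
    have int: "integrable M (\<lambda>\<omega>. \<bar>X t \<omega> - c\<bar> powr p)"
      by (rule Bochner_Integration.integrable_bound[OF intB])
        (use le in \<open>auto intro!: AE_I2 intro: order_trans[OF _ abs_ge_self]\<close>)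
    have "expectation (\<lambda>\<omega>. \<bar>X t \<omega> - c\<bar> powr p) \<le> expectation ?B"
      using int intB le by (intro integral_mono) auto
    also have "\<dots> = e + C * (expectation (\<lambda>\<omega>. exp (X t \<omega> - c)) + expectation (\<lambda>\<omega>. exp (c - X t \<omega>)) - 2)"
      using X by (simp add: prob_space)
    also have "\<dots> \<le> e + C * (2 * exp (m t) - 2)"
      using X C by (intro add_left_mono mult_left_mono) auto
    finally show ?thesis using int by simp
  qed
  have "((\<lambda>t. expectation (\<lambda>\<omega>. \<bar>X t \<omega> - c\<bar> powr p)) \<longlongrightarrow> 0) F"
  proof (rule tendstoI)
    fix e :: real assume e: "0 < e"
    obtain C where C: "0 \<le> C" "\<And>x. \<bar>x\<bar> powr p \<le> e / 2 + C * (exp x + exp (- x) - 2)"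
      using abs_powr_le_cosh[OF p, of "e / 2"] e by auto
    have "((\<lambda>t. e / 2 + C * (2 * exp (m t) - 2)) \<longlongrightarrow> e / 2 + C * (2 * exp 0 - 2)) F"
      by (intro tendsto_intros m)
    then have "\<forall>\<^sub>F t in F. e / 2 + C * (2 * exp (m t) - 2) < e"
      using e by (intro order_tendstoD(2)[where y = "e / 2"]) auto
    with ev show "\<forall>\<^sub>F t in F. dist (expectation (\<lambda>\<omega>. \<bar>X t \<omega> - c\<bar> powr p)) 0 < e"
    proof eventually_elim
      case (elim t)
      have "0 \<le> expectation (\<lambda>\<omega>. \<bar>X t \<omega> - c\<bar> powr p)" by (intro integral_nonneg_AE) auto
      then show ?case using bound[OF elim(1) C] elim(2) by simp
    qed
  qed
  moreover have "\<forall>\<^sub>F t in F. X t \<in> borel_measurable M \<and> integrable M (\<lambda>\<omega>. \<bar>X t \<omega> - c\<bar> powr p)"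
  proof -
    obtain C where C: "0 \<le> C" "\<And>x. \<bar>x\<bar> powr p \<le> 1 + C * (exp x + exp (- x) - 2)"
      using abs_powr_le_cosh[OF p, of 1] by auto
    show ?thesis using ev by eventually_elim (use bound[OF _ C] in auto)
  qed
  ultimately show ?thesis by (simp add: tends_in_Lp_def)
qed

context standard_gamma_process
begin

text \<open>With s = 1 and s = -1 both signs are treated at once. The linear part of - ln (1 - s q)
  integrates to s and cancels the centring factor exp (- s); the remainder is at most 2 q^2 \<le> 2
  m q, with integral 2 m. The condition m \<le> 1/2 is the range of the quadratic estimate of the
  logarithm.\<close>

lemma exp_centred_integral_bound:
  fixes q :: "real \<Rightarrow> real"
  assumes t: "0 < t" and [measurable]: "q \<in> borel_measurable borel"
    and q: "\<And>x. 0 \<le> q x" "\<And>x. q x \<le> m" and m: "m \<le> 1 / 2" and one: "(\<integral>x. q x \<partial>leb t) = 1"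
    and s: "\<bar>s\<bar> = 1"
  shows "integrable M (\<lambda>\<omega>. exp (s * ((\<integral>x. q x \<partial>jump_measure t \<omega>) - 1)))"
    and "expectation (\<lambda>\<omega>. exp (s * ((\<integral>x. q x \<partial>jump_measure t \<omega>) - 1))) \<le> exp (2 * m)"
proof -
  have sq: "\<bar>s * q x\<bar> = q x" for x using q(1)[of x] s by (simp add: abs_mult)
  have bd: "- m \<le> s * q x" "s * q x \<le> m" for x using sq[of x] q(2)[of x] by linarith+
  have m1: "m < 1" using m by simp
  note B = exp_integral_bound[of t "\<lambda>x. s * q x" "- m" m, OF t _ bd m1]
  have intq: "integrable (leb t) q"
    using q by (intro leb.integrable_const_bound[where B = m]) auto
  have eq: "exp (s * ((\<integral>x. q x \<partial>jump_measure t \<omega>) - 1)) =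
      exp (- s) * exp (\<integral>x. s * q x \<partial>jump_measure t \<omega>)" for \<omega>
    by (simp add: right_diff_distrib flip: exp_add)
  show "integrable M (\<lambda>\<omega>. exp (s * ((\<integral>x. q x \<partial>jump_measure t \<omega>) - 1)))"
    unfolding eq using B(1) by simp
  have pt: "\<bar>ln (1 - s * q x) + s * q x\<bar> \<le> 2 * m * q x" for x
  proof -
    have "\<bar>ln (1 + - (s * q x)) - - (s * q x)\<bar> \<le> 2 * (- (s * q x))\<^sup>2"
      using sq[of x] q(2)[of x] m by (intro abs_ln_one_plus_x_minus_x_bound) simp
    also have "(- (s * q x))\<^sup>2 = (q x)\<^sup>2" using sq[of x] by (metis power2_abs power2_minus)
    also have "2 * (q x)\<^sup>2 \<le> 2 * m * q x"
      using mult_right_mono[OF q(2)[of x] q(1)[of x]] by (simp add: power2_eq_square)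
    finally show ?thesis by simp
  qed
  have intln: "integrable (leb t) (\<lambda>x. ln (1 - s * q x))"
  proof -
    have "integrable (leb t) (\<lambda>x. ln (1 - s * q x) + s * q x)"
      by (rule Bochner_Integration.integrable_bound[of _ "\<lambda>x. 2 * m * q x"])
        (use intq pt in \<open>auto intro!: AE_I2 intro: order_trans[OF _ abs_ge_self]\<close>)
    then have "integrable (leb t) (\<lambda>x. (ln (1 - s * q x) + s * q x) - s * q x)"
      using intq by (intro Bochner_Integration.integrable_diff integrable_mult_right)
    then show ?thesis by simp
  qed
  have "- (\<integral>x. ln (1 - s * q x) \<partial>leb t) = (\<integral>x. - ln (1 - s * q x) \<partial>leb t)" by simp
  also have "\<dots> \<le> (\<integral>x. (s + 2 * m) * q x \<partial>leb t)"
  proof (rule integral_mono)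
    show "- ln (1 - s * q x) \<le> (s + 2 * m) * q x" for x
      using pt[of x] by (simp add: algebra_simps abs_le_iff)
  qed (use intq intln in auto)
  also have "\<dots> = s + 2 * m" using one by simp
  finally have ln: "- (\<integral>x. ln (1 - s * q x) \<partial>leb t) \<le> s + 2 * m" .
  have "expectation (\<lambda>\<omega>. exp (s * ((\<integral>x. q x \<partial>jump_measure t \<omega>) - 1))) =
      exp (- s) * expectation (\<lambda>\<omega>. exp (\<integral>x. s * q x \<partial>jump_measure t \<omega>))"
    unfolding eq by simp
  also have "\<dots> \<le> exp (- s) * exp (s + 2 * m)"
    using ln by (intro mult_left_mono order_trans[OF B(2)]) auto
  also have "\<dots> = exp (2 * m)" by (simp flip: exp_add)
  finally show "expectation (\<lambda>\<omega>. exp (s * ((\<integral>x. q x \<partial>jump_measure t \<omega>) - 1))) \<le> exp (2 * m)" .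
qed

end

theorem theorem2p1:
  fixes M :: "'a measure" and S :: "real \<Rightarrow> 'a \<Rightarrow> real" and f g :: "real \<Rightarrow> real"
  assumes "standard_gamma_process M S"
    and "\<And>x. x \<ge> 0 \<Longrightarrow> f x \<ge> 0"
    and "mono_on {0..} f"
    and "filterlim (\<lambda>t. lam t f) at_top at_top"
    and "orderly_divergence M S f"
    and "\<And>x. x \<ge> 0 \<Longrightarrow> g x \<ge> 0"
    and "g \<in> borel_measurable (restrict_space borel {0..})"
    and "\<exists>T>0. \<forall>x\<ge>0. g (x + T) = g x"
    and "esssup (restrict_space lborel {0..}) (\<lambda>x. ereal (g x)) = 1"
  shows "(\<exists>C. \<forall>\<^sub>F t in at_top. vt t (\<lambda>x. f x * g x) \<le> C * vt t f) \<and>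
    orderly_divergence M S (\<lambda>x. f x * g x) \<and>
    (\<forall>p>0. orderly_divergence_Lp p M S (\<lambda>x. f x * g x))"
proof -
  interpret standard_gamma_process M S by fact
  \<comment> \<open>Constant continuation to the negative half-line makes \<open>F\<close>
    increasing, and \<open>G\<close> Borel, on the whole line.\<close>
  define F where "F x = f (max 0 x)" for x
  define G where "G x = g (max 0 x)" for x
  \<comment> \<open>The essential bound on \<open>g\<close> becomes a pointwise one;
    \<open>H\<close> agrees with \<open>G\<close> almost everywhere and keeps the period.\<close>
  define H where "H x = min 1 (G x)" for x
  have F_mono: "mono F"
    using assms(3) by (auto simp: F_def mono_def mono_on_def)
  have F_nonneg: "0 \<le> F x" for x using assms(2) by (simp add: F_def)
  have F_meas [measurable]: "F \<in> borel_measurable borel" using F_mono by (rule borel_measurable_mono)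
  have fF: "f x = F x" if "0 < x" for x using that by (simp add: F_def)
  have G_meas [measurable]: "G \<in> borel_measurable borel"
  proof -
    have "(\<lambda>x::real. max 0 x) \<in> borel \<rightarrow>\<^sub>M restrict_space borel {0..}"
      by (rule measurable_restrict_space2) auto
    then show ?thesis unfolding G_def by (rule measurable_compose[OF _ assms(7)])
  qed
  have G_nonneg: "0 \<le> G x" for x using assms(6) by (simp add: G_def)
  have gG: "g x = G x" if "0 < x" for x using that by (simp add: G_def)
  have H_meas [measurable]: "H \<in> borel_measurable borel" unfolding H_def by measurable
  have H: "0 \<le> H x" "H x \<le> 1" for x using G_nonneg by (auto simp: H_def)
  have "AE x in restrict_space lborel {0..}. ereal (g x) \<le> 1"
    using esssup_AE[of "\<lambda>x. ereal (g x)" "restrict_space lborel {0..}"] assms(9) by simp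
  then have g_le: "AE x in lborel. 0 \<le> x \<longrightarrow> g x \<le> 1"
    by (subst (asm) AE_restrict_space_iff) auto
  have GH: "AE x in leb t. G x = H x" for t
    unfolding AE_leb using g_le by eventually_elim (auto simp: H_def G_def)
  obtain T where T: "0 < T" and per_g: "\<And>x. 0 \<le> x \<Longrightarrow> g (x + T) = g x" using assms(8) by blast
  have per: "H (x + T) = H x" if "0 \<le> x" for x
    using per_g[OF that] that T by (simp add: H_def G_def)
  \<comment> \<open>If \<open>H\<close> had no mass on one period, it would vanish almost everywhere
    on every period, and the essential supremum of \<open>g\<close> would be at most 0 instead of
    1.\<close>
  have H_pos: "0 < (\<integral>x. H x \<partial>leb T)"
  proof (rule ccontr)
    have intH: "integrable (leb t) H" for t
      using H by (intro leb.integrable_const_bound[where B = 1]) auto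
    have nonneg: "0 \<le> (\<integral>x. H x \<partial>leb t)" for t using H by (intro integral_nonneg_AE) auto
    assume "\<not> 0 < (\<integral>x. H x \<partial>leb T)"
    then have "(\<integral>x. H x \<partial>leb T) = 0" using nonneg[of T] by simp
    then have zero: "AE x in lborel. 0 < x \<and> x \<le> T \<longrightarrow> H x = 0"
      using intH H by (simp add: integral_nonneg_eq_0_iff_AE AE_leb)
    have shift: "AE x in lborel. real n * T < x \<and> x \<le> real (Suc n) * T \<longrightarrow> H x = 0" for n
    proof (induction n)
      case 0
      then show ?case using zero by simp
    next
      case (Suc n)
      have "AE x in lborel. real n * T < - T + 1 * x \<and> - T + 1 * x \<le> real (Suc n) * T \<longrightarrow> H (- T + 1 * x) = 0"
        by (rule AE_borel_affine) (use Suc in auto)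
      then show ?case
      proof eventually_elim
        case (elim x)
        show ?case
        proof
          assume x: "real (Suc n) * T < x \<and> x \<le> real (Suc (Suc n)) * T"
          then have "real n * T < x - T" "x - T \<le> real (Suc n) * T" by (auto simp: algebra_simps)
          moreover have "0 \<le> real n * T" using T by simp
          ultimately show "H x = 0" using elim per[of "x - T"] by auto
        qed
      qed
    qed
    have "AE x in lborel. \<forall>n. real n * T < x \<and> x \<le> real (Suc n) * T \<longrightarrow> H x = 0"
      using shift by (subst AE_all_countable) blast
    then have "AE x in lborel. 0 \<le> x \<longrightarrow> g x \<le> 0"
      using AE_lborel_singleton[of 0]
    proof eventually_elim
      case (elim x)
      show ?case
      proof
        assume "0 \<le> x"
        then have x: "0 < x" using elim by simp
        \<comment> \<open>Windows are open on the left, so the one containing x is found by rounding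
          x / T up and subtracting 1.\<close>
        define n where "n = nat (\<lceil>x / T\<rceil> - 1)"
        have "0 < x / T" using x T by simp
        then have "real n = of_int \<lceil>x / T\<rceil> - 1" unfolding n_def by linarith
        then have "real n < x / T" "x / T \<le> real (Suc n)" by linarith+
        then have "H x = 0" using elim T by (auto simp: field_simps)
        then show "g x \<le> 0" using x by (simp add: H_def G_def min_def split: if_splits)
      qed
    qed
    then have "AE x in restrict_space lborel {0..}. ereal (g x) \<le> 0"
      by (subst AE_restrict_space_iff) auto
    moreover have "(\<lambda>x. ereal (g x)) \<in> borel_measurable (restrict_space lborel {0..})"
    proof (rule borel_measurable_ereal)
      have "sets (restrict_space lborel {0::real..}) = sets (restrict_space borel {0..})"
        by (simp add: sets_restrict_space)
      then show "g \<in> borel_measurable (restrict_space lborel {0..})"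
        using assms(7) by (simp cong: measurable_cong_sets)
    qed
    ultimately have "esssup (restrict_space lborel {0..}) (\<lambda>x. ereal (g x)) \<le> 0"
      by (intro esssup_I)
    then show False using assms(9) by simp
  qed
  define \<Lambda> where "\<Lambda> t = (\<integral>x. F x \<partial>leb t)" for t
  define L where "L t = (\<integral>x. F x * H x \<partial>leb t)" for t
  have lam_f: "lam t f = \<Lambda> t" for t
    unfolding \<Lambda>_def by (intro lam_eq_integral_leb) (auto simp: fF)
  have lam_fg: "lam t (\<lambda>x. f x * g x) = L t" for t
  proof -
    have "lam t (\<lambda>x. f x * g x) = (\<integral>x. F x * G x \<partial>leb t)"
      by (intro lam_eq_integral_leb) (auto simp: fF gG)
    also have "\<dots> = L t"
      unfolding L_def by (rule integral_cong_AE) (use GH[of t] in auto)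
    finally show ?thesis .
  qed
  have div: "filterlim (\<lambda>t. \<integral>x. F x \<partial>leb t) at_top at_top"
    using assms(4) by (simp add: lam_f \<Lambda>_def)
  have pi_f: "path_integral S t f \<omega> = (\<integral>x. F x \<partial>jump_measure t \<omega>)" for t \<omega>
    by (intro path_integral_eq) (auto simp: fF)
  have ratio: "((\<lambda>t. F t / \<Lambda> t) \<longlongrightarrow> 0) at_top"
    unfolding \<Lambda>_def using assms(5)
    by (intro orderly_divergence_imp_ratio_tendsto_0 F_mono F_nonneg div)
      (simp add: orderly_divergence_def pi_f lam_f \<Lambda>_def)
  obtain c where c: "0 < c" and L_ge: "\<forall>\<^sub>F t in at_top. c * \<Lambda> t \<le> L t"
    unfolding \<Lambda>_def L_def
    using integral_leb_periodic_eventually[OF F_mono F_nonneg H_meas H T per H_pos ratio[unfolded \<Lambda>_def] div]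
    by metis
  have \<Lambda>_pos: "\<forall>\<^sub>F t in at_top. 0 < \<Lambda> t" using div by (simp add: filterlim_at_top_dense \<Lambda>_def)
  have "\<exists>C. \<forall>\<^sub>F t in at_top. vt t (\<lambda>x. f x * g x) \<le> C * vt t f"
  proof (intro exI)
    show "\<forall>\<^sub>F t in at_top. vt t (\<lambda>x. f x * g x) \<le> 1 / c\<^sup>2 * vt t f"
      using L_ge \<Lambda>_pos
    proof eventually_elim
      case (elim t)
      have int: "integrable (leb t) (\<lambda>x. (k x)\<^sup>2)"
        if [measurable]: "k \<in> borel_measurable borel" and k: "\<And>x. \<bar>k x\<bar> \<le> F x" for k
      proof (rule leb.integrable_const_bound)
        show "AE x in leb t. norm ((k x)\<^sup>2) \<le> (F t)\<^sup>2"
          using AE_leb_Ioc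
        proof eventually_elim
          case (elim x)
          then have "\<bar>k x\<bar> \<le> F t" using k[of x] monoD[OF F_mono, of x t] by simp
          then show ?case by (simp add: abs_le_square_iff[symmetric] F_nonneg)
        qed
      qed measurable
      have FH: "\<bar>F x * H x\<bar> \<le> F x" for x using F_nonneg[of x] H[of x] by (simp add: abs_mult mult_left_le)
      have "lam t (\<lambda>x. (f x * g x)\<^sup>2) = (\<integral>x. (F x * G x)\<^sup>2 \<partial>leb t)"
        by (intro lam_eq_integral_leb) (auto simp: fF gG)
      also have "\<dots> = (\<integral>x. (F x * H x)\<^sup>2 \<partial>leb t)"
        by (rule integral_cong_AE) (use GH[of t] in auto)
      also have "\<dots> \<le> (\<integral>x. (F x)\<^sup>2 \<partial>leb t)"
      proof (rule integral_mono)
        show "(F x * H x)\<^sup>2 \<le> (F x)\<^sup>2" for x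
          using FH[of x] by (simp add: abs_le_square_iff[symmetric] F_nonneg)
      qed (use int FH F_nonneg in auto)
      also have "\<dots> = lam t (\<lambda>x. (f x)\<^sup>2)"
        by (intro lam_eq_integral_leb[symmetric]) (auto simp: fF)
      finally have le: "lam t (\<lambda>x. (f x * g x)\<^sup>2) \<le> lam t (\<lambda>x. (f x)\<^sup>2)" .
      have nn: "0 \<le> lam t (\<lambda>x. (f x)\<^sup>2)"
        unfolding lam_def set_lebesgue_integral_def by (intro integral_nonneg_AE) auto
      \<comment> \<open>Numerator: g \<le> 1 almost everywhere. Denominator: the integral of
        \<open>f g\<close> is at least c times that of \<open>f\<close>, which yields the constant 1
        / c^2.\<close>
      have "vt t (\<lambda>x. f x * g x) \<le> lam t (\<lambda>x. (f x)\<^sup>2) / (c * \<Lambda> t)\<^sup>2"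
        unfolding vt_def lam_fg using le nn elim c by (intro frac_le power_mono) auto
      then show ?case by (simp add: vt_def lam_f power_mult_distrib)
    qed
  qed
  moreover have Lp: "orderly_divergence_Lp p M S (\<lambda>x. f x * g x)" if p: "0 < p" for p
    unfolding orderly_divergence_Lp_def
  \<comment> \<open>F t / \<Lambda> t / c bounds the normalised integrand on (0, t]; the factor 2 is
    that of \<open>exp_centred_integral_bound\<close>.\<close>
  proof (rule tends_in_Lp_of_exp_bounds[OF p, where m = "\<lambda>t. 2 * (F t / \<Lambda> t / c)"])
    have m_lim: "((\<lambda>t. F t / \<Lambda> t / c) \<longlongrightarrow> 0) at_top"
      using tendsto_divide[OF ratio tendsto_const, of c] c by simp
    then show "((\<lambda>t. 2 * (F t / \<Lambda> t / c)) \<longlongrightarrow> 0) at_top"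
      using tendsto_mult[OF tendsto_const m_lim, of 2] by simp
    have "\<forall>\<^sub>F t in at_top. F t / \<Lambda> t / c < 1 / 2" using m_lim by (rule order_tendstoD(2)) simp
    moreover have "\<forall>\<^sub>F t::real in at_top. 0 < t" by (rule eventually_gt_at_top)
    ultimately show "\<forall>\<^sub>F t in at_top.
        (\<lambda>\<omega>. path_integral S t (\<lambda>x. f x * g x) \<omega> / lam t (\<lambda>x. f x * g x)) \<in> borel_measurable M \<and>
        integrable M (\<lambda>\<omega>. exp (path_integral S t (\<lambda>x. f x * g x) \<omega> / lam t (\<lambda>x. f x * g x) - 1)) \<and>
        expectation (\<lambda>\<omega>. exp (path_integral S t (\<lambda>x. f x * g x) \<omega> / lam t (\<lambda>x. f x * g x) - 1))
          \<le> exp (2 * (F t / \<Lambda> t / c)) \<and>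
        integrable M (\<lambda>\<omega>. exp (1 - path_integral S t (\<lambda>x. f x * g x) \<omega> / lam t (\<lambda>x. f x * g x))) \<and>
        expectation (\<lambda>\<omega>. exp (1 - path_integral S t (\<lambda>x. f x * g x) \<omega> / lam t (\<lambda>x. f x * g x)))
          \<le> exp (2 * (F t / \<Lambda> t / c))"
      using L_ge \<Lambda>_pos
    proof eventually_elim
      case (elim t)
      define X where "X \<omega> = path_integral S t (\<lambda>x. f x * g x) \<omega> / lam t (\<lambda>x. f x * g x)" for \<omega>
      \<comment> \<open>Normalised integrand, with \<open>F\<close> frozen after t and
        \<open>H\<close> in place of \<open>G\<close>, so that its bounds hold at every real
        x.\<close>
      define q where "q x = F (min x t) * H x / L t" for x
      have L: "0 < c * \<Lambda> t" "c * \<Lambda> t \<le> L t" using elim c by auto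
      have q_meas [measurable]: "q \<in> borel_measurable borel" unfolding q_def by measurable
      have q: "0 \<le> q x" "q x \<le> F t / \<Lambda> t / c" for x
      proof -
        show "0 \<le> q x" using F_nonneg H L by (auto simp: q_def intro!: divide_nonneg_nonneg)
        have "F (min x t) * H x \<le> F t * 1"
          using F_nonneg H monoD[OF F_mono, of "min x t" t] by (intro mult_mono) auto
        then have "q x \<le> F t / (c * \<Lambda> t)"
          unfolding q_def using L F_nonneg by (intro frac_le) auto
        then show "q x \<le> F t / \<Lambda> t / c" by (simp add: mult.commute)
      qed
      have one: "(\<integral>x. q x \<partial>leb t) = 1"
      proof -
        have "(\<integral>x. q x \<partial>leb t) = (\<integral>x. F x * H x / L t \<partial>leb t)"
        proof (rule integral_cong_AE)
          show "AE x in leb t. q x = F x * H x / L t"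
            using AE_leb_Ioc by eventually_elim (simp add: q_def min_def)
        qed measurable
        then show ?thesis using L by (simp add: L_def)
      qed
      have pi: "path_integral S t (\<lambda>x. f x * g x) \<omega> = (\<integral>x. F x * G x \<partial>jump_measure t \<omega>)" for \<omega>
        by (intro path_integral_eq) (auto simp: fF gG)
      have X_meas [measurable]: "X \<in> borel_measurable M"
        unfolding X_def[abs_def] pi using F_nonneg G_nonneg elim
        by (intro borel_measurable_divide borel_measurable_const measurable_integral_jump_measure) auto
      have "AE \<omega> in M. AE x in jump_measure t \<omega>. G x = H x"
        using GH[of t] elim by (intro AE_jump_measure) auto
      \<comment> \<open>The path integral involves \<open>G\<close> and \<open>q\<close> involves
        \<open>H\<close>; the two agree only on almost every path, so the exponential bounds are
        transferred up to a null set.\<close>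
      then have XY: "AE \<omega> in M. (\<integral>x. q x \<partial>jump_measure t \<omega>) = X \<omega>"
      proof eventually_elim
        case (elim \<omega>)
        have "(\<integral>x. q x \<partial>jump_measure t \<omega>) = (\<integral>x. F x * G x / L t \<partial>jump_measure t \<omega>)"
        proof (rule integral_cong_AE)
          show "AE x in jump_measure t \<omega>. q x = F x * G x / L t"
            using AE_jump_measure_Ioc elim by eventually_elim (simp add: q_def min_def)
        qed measurable
        then show ?case by (simp add: X_def pi lam_fg)
      qed
      have exp_X: "integrable M (\<lambda>\<omega>. exp (s * (X \<omega> - 1))) \<and>
          expectation (\<lambda>\<omega>. exp (s * (X \<omega> - 1))) \<le> exp (2 * (F t / \<Lambda> t / c))" if s: "\<bar>s\<bar> = 1" for s
      proof -
        have t: "0 < t" and m: "F t / \<Lambda> t / c \<le> 1 / 2" using elim by auto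
        note B = exp_centred_integral_bound[OF t q_meas q m one s]
        have ae: "AE \<omega> in M. exp (s * ((\<integral>x. q x \<partial>jump_measure t \<omega>) - 1)) = exp (s * (X \<omega> - 1))"
          using XY by eventually_elim simp
        have meas: "(\<lambda>\<omega>. exp (s * (X \<omega> - 1))) \<in> borel_measurable M" by measurable
        show ?thesis
          using B integrable_cong_AE_imp[OF B(1) meas ae]
            integral_cong_AE[OF borel_measurable_integrable[OF B(1)] meas ae] by simp
      qed
      show ?case
        using exp_X[of 1] exp_X[of "-1"] X_meas unfolding X_def by simp
    qed
  qed
  moreover have "orderly_divergence M S (\<lambda>x. f x * g x)"
    using Lp[of 1] unfolding orderly_divergence_def orderly_divergence_Lp_def
    by (intro tends_in_Lp_imp_in_probability) simp
  ultimately show ?thesis by blast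
qed

end
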